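(* Let $X$ be a subshift and let $R$ be a field. Then $$\mathrm{Soc}\big(\widetilde{\mathcal A}_R(X)\big)=\sum_{A\in\mathcal Q_X}\widetilde{\mathcal A}_R(X)\,p_A .$$
   Context: Notation: $\mathbb N=\{0,1,2,\dots\}$. Let $\mathfrak A$ be a nonempty set (the alphabet) and let $\mathfrak A^*$ be the set of finite words over $\mathfrak A$, including the empty word $\omega$. For a nonempty word $\beta$, $\beta^\infty=\beta\beta\beta\cdots\in\mathfrak A^{\mathbb N}$. A subshift over $\mathfrak A$ is a set $X\subseteq\mathfrak A^{\mathbb N}$ of the form $X=X_F$ for some $F\subseteq\mathfrak A^*$, where $X_F$ is the set of all sequences in which no word of $F$ occurs as a block. The language $\mathcal L_X$ is the set of all finite words (including $\omega$) occurring in some element of $X$. For $\alpha,\beta\in\mathcal L_X$ put $C(\alpha,\beta)=\{\beta x\in X:\alpha x\in X\}$. Let $\mathcal U$ be the Boolean algebra of subsets of $X$ generated by all $C(\alpha,\beta)$, $\alpha,\beta\in\mathcal L_X$ (closed under finite unions, finite intersections and complements in $X$). The unital subshift algebra $\widetilde{\mathcal A}_R(X)$ is the universal unital (associative) $R$-algebra with generators $\{p_A:A\in\mathcal U\}$ and $\{s_a,s_a^*:a\in\mathfrak A\}$ subject to: (i) $p_X=1$, $p_{A\cap B}=p_Ap_B$, $p_{A\cup B}=p_A+p_B-p_{A\cap B}$, $p_\emptyset=0$ for all $A,B\in\mathcal U$; (ii) $s_as_a^*s_a=s_a$ and $s_a^*s_as_a^*=s_a^*$ for all $a\in\mathfrak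 A$; (iii) $s_\beta s_\alpha^*s_\alpha s_\beta^*=p_{C(\alpha,\beta)}$ for all $\alpha,\beta\in\mathcal L_X$, where $s_\omega=s_\omega^*=1$, $s_\alpha=s_{\alpha_1}\cdots s_{\alpha_n}$ and $s_\alpha^*=s_{\alpha_n}^*\cdots s_{\alpha_1}^*$ for $\alpha=\alpha_1\cdots\alpha_n$. $\mathcal Q_X$ denotes the set of all one-point sets $\{p\}\in\mathcal U$ such that $p\neq\alpha\beta^\infty$ for all $\alpha,\beta\in\mathcal L_X$ with $\beta\ne\omega$. The (left) socle $\mathrm{Soc}(B)$ of an algebra $B$ is the sum of all minimal left ideals of $B$ (zero if there are none).
   Formalization: It is additionally assumed that, if X is nonempty, every letter of the alphabet occurs in X; otherwise an unused letter b gives generators s_b, s_b^* subject only to (ii), and the formula fails, e.g. for X={(n,n+1,...)} over the naturals with an extra letter b. *)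

theory Defs
  imports "HOL-Algebra.QuotRing" "HOL-Library.Omega_Words_Fun"
begin

section \<open>Associative algebras given by generators and relations\<close>

text \<open>
  The free unital associative \<open>'r\<close>-algebra on the set \<open>G\<close>: finitely supported
  functions on the words over \<open>G\<close>, with convolution along concatenation. The
  scalars are the multiples of the empty word; hence every (left, two-sided) ideal
  of this ring, or of a quotient of it, is automatically closed under scalar multiplication.
\<close>

definition free_algebra :: "'g set \<Rightarrow> ('g list \<Rightarrow> 'r::comm_ring_1) ring" where
  "free_algebra G =
    \<lparr>carrier = {f. finite {w. f w \<noteq> 0} \<and> (\<forall>w. f w \<noteq> 0 \<longrightarrow> set w \<subseteq> G)},
     mult = (\<lambda>f g w. \<Sum>i\<le>length w. f (take i w) * g (drop i w)),
     one = (\<lambda>w. if w = [] then 1 else 0),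
     zero = (\<lambda>w. 0),
     add = (\<lambda>f g w. f w + g w)\<rparr>"

definition monomial :: "'g list \<Rightarrow> 'g list \<Rightarrow> 'r::comm_ring_1" where
  "monomial w = (\<lambda>v. if v = w then 1 else 0)"

text \<open>A pair \<open>(f, g)\<close> in \<open>Rel\<close> stands for the relation \<open>f = g\<close>.\<close>

definition relation_ideal ::
  "'g set \<Rightarrow> (('g list \<Rightarrow> 'r::comm_ring_1) \<times> ('g list \<Rightarrow> 'r)) set \<Rightarrow> ('g list \<Rightarrow> 'r) set" where
  "relation_ideal G Rel =
    Idl\<^bsub>free_algebra G\<^esub> {f \<ominus>\<^bsub>free_algebra G\<^esub> g | f g. (f, g) \<in> Rel}"

definition presented_algebra ::
  "'g set \<Rightarrow> (('g list \<Rightarrow> 'r::comm_ring_1) \<times> ('g list \<Rightarrow> 'r)) set \<Rightarrow> ('g list \<Rightarrow> 'r) set ring" where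
  "presented_algebra G Rel = free_algebra G Quot relation_ideal G Rel"

text \<open>
  \<open>Idl\<close> and \<open>Quot\<close> are meaningful only over a ring.
\<close>

lemma ring_free_algebra: "ring (free_algebra G :: ('g list \<Rightarrow> 'r::comm_ring_1) ring)"
proof (rule ringI)
  let ?A = "free_algebra G :: ('g list \<Rightarrow> 'r) ring"
  have fin_add: "finite {w. f w + g w \<noteq> 0}"
    if "finite {w. f w \<noteq> 0}" "finite {w. g w \<noteq> 0}" for f g :: "'g list \<Rightarrow> 'r"
    by (rule finite_subset[OF _ finite_UnI[OF that]]) auto
  have supp_mult: "\<exists>u v. w = u @ v \<and> f u \<noteq> 0 \<and> g v \<noteq> 0"
    if nz: "(\<Sum>i\<le>length w. f (take i w) * g (drop i w)) \<noteq> 0" for f g :: "'g list \<Rightarrow> 'r" and w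
  proof -
    obtain i where "f (take i w) * g (drop i w) \<noteq> 0"
      by (rule sum.not_neutral_contains_not_neutral[OF nz])
    then have "w = take i w @ drop i w \<and> f (take i w) \<noteq> 0 \<and> g (drop i w) \<noteq> 0" by auto
    then show ?thesis by blast
  qed
  have fin_mult: "finite {w. (\<Sum>i\<le>length w. f (take i w) * g (drop i w)) \<noteq> 0}"
    if "finite {w. f w \<noteq> 0}" "finite {w. g w \<noteq> 0}" for f g :: "'g list \<Rightarrow> 'r"
  proof (rule finite_subset)
    show "{w. (\<Sum>i\<le>length w. f (take i w) * g (drop i w)) \<noteq> 0}
        \<subseteq> (\<lambda>(u, v). u @ v) ` ({w. f w \<noteq> 0} \<times> {w. g w \<noteq> 0})"
    proof
      fix w assume "w \<in> {w. (\<Sum>i\<le>length w. f (take i w) * g (drop i w)) \<noteq> 0}"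
      then obtain u v where uv: "w = u @ v" "f u \<noteq> 0" "g v \<noteq> 0"
        using supp_mult[of f w g] by blast
      then show "w \<in> (\<lambda>(u, v). u @ v) ` ({w. f w \<noteq> 0} \<times> {w. g w \<noteq> 0})"
        by (intro image_eqI[of _ _ "(u, v)"]) auto
    qed
  qed (intro finite_imageI finite_cartesian_product that)
  show "abelian_group ?A"
  proof (rule abelian_groupI)
    fix x y :: "'g list \<Rightarrow> 'r"
    assume x: "x \<in> carrier ?A" and y: "y \<in> carrier ?A"
    have "set w \<subseteq> G" if "x w + y w \<noteq> 0" for w
      using that x y by (cases "x w = 0") (simp_all add: free_algebra_def)
    with x y show "x \<oplus>\<^bsub>?A\<^esub> y \<in> carrier ?A"
      by (simp add: free_algebra_def fin_add)
  next
    fix x assume "x \<in> carrier ?A"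
    then show "\<exists>y\<in>carrier ?A. y \<oplus>\<^bsub>?A\<^esub> x = \<zero>\<^bsub>?A\<^esub>"
      by (intro bexI[of _ "\<lambda>w. - x w"]) (auto simp: free_algebra_def)
  qed (auto simp: free_algebra_def algebra_simps)
  show "monoid ?A"
  proof (rule monoidI)
    fix f g :: "'g list \<Rightarrow> 'r"
    assume f: "f \<in> carrier ?A" and g: "g \<in> carrier ?A"
    have "set w \<subseteq> G" if nz: "(\<Sum>i\<le>length w. f (take i w) * g (drop i w)) \<noteq> 0" for w
    proof -
      obtain u v where "w = u @ v" "f u \<noteq> 0" "g v \<noteq> 0" using supp_mult[OF nz] by blast
      then show ?thesis using f g by (auto simp: free_algebra_def)
    qed
    with f g show "f \<otimes>\<^bsub>?A\<^esub> g \<in> carrier ?A"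
      by (simp add: free_algebra_def fin_mult)
  next
    have "{w::'g list. w = []} = {[]}" by auto
    then show "\<one>\<^bsub>?A\<^esub> \<in> carrier ?A"
      by (simp add: free_algebra_def)
  next
    fix f g h :: "'g list \<Rightarrow> 'r"
    show "f \<otimes>\<^bsub>?A\<^esub> g \<otimes>\<^bsub>?A\<^esub> h = f \<otimes>\<^bsub>?A\<^esub> (g \<otimes>\<^bsub>?A\<^esub> h)"
    proof
      fix w :: "'g list"
      let ?n = "length w"
      have "(f \<otimes>\<^bsub>?A\<^esub> g \<otimes>\<^bsub>?A\<^esub> h) w =
          (\<Sum>i\<le>?n. \<Sum>j\<le>i. f (take j w) * g (drop j (take i w)) * h (drop i w))"
        by (auto simp: free_algebra_def sum_distrib_right min_absorb1 min_absorb2 intro!: sum.cong)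
      also have "\<dots> = (\<Sum>(i,j)\<in>(SIGMA i:{..?n}. {..i}).
          f (take j w) * g (drop j (take i w)) * h (drop i w))"
        by (rule sum.Sigma) auto
      also have "\<dots> = (\<Sum>(j,k)\<in>(SIGMA j:{..?n}. {..?n - j}).
          f (take j w) * (g (take k (drop j w)) * h (drop k (drop j w))))"
        by (rule sum.reindex_bij_witness[of _ "\<lambda>(j,k). (j + k, j)" "\<lambda>(i,j). (j, i - j)"])
          (auto simp: drop_take mult.assoc)
      also have "\<dots> = (\<Sum>j\<le>?n. \<Sum>k\<le>?n - j.
          f (take j w) * (g (take k (drop j w)) * h (drop k (drop j w))))"
        by (rule sum.Sigma[symmetric]) auto
      also have "\<dots> = (f \<otimes>\<^bsub>?A\<^esub> (g \<otimes>\<^bsub>?A\<^esub> h)) w"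
        by (simp add: free_algebra_def sum_distrib_left)
      finally show "(f \<otimes>\<^bsub>?A\<^esub> g \<otimes>\<^bsub>?A\<^esub> h) w = (f \<otimes>\<^bsub>?A\<^esub> (g \<otimes>\<^bsub>?A\<^esub> h)) w" .
    qed
  next
    fix f :: "'g list \<Rightarrow> 'r"
    show "\<one>\<^bsub>?A\<^esub> \<otimes>\<^bsub>?A\<^esub> f = f"
    proof
      fix w :: "'g list"
      have "(\<one>\<^bsub>?A\<^esub> \<otimes>\<^bsub>?A\<^esub> f) w = (\<Sum>i\<le>length w. if i = 0 then f w else 0)"
        unfolding free_algebra_def ring.simps monoid.simps by (intro sum.cong) auto
      then show "(\<one>\<^bsub>?A\<^esub> \<otimes>\<^bsub>?A\<^esub> f) w = f w" by simp
    qed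
    show "f \<otimes>\<^bsub>?A\<^esub> \<one>\<^bsub>?A\<^esub> = f"
    proof
      fix w :: "'g list"
      have "(f \<otimes>\<^bsub>?A\<^esub> \<one>\<^bsub>?A\<^esub>) w = (\<Sum>i\<le>length w. if i = length w then f w else 0)"
        unfolding free_algebra_def ring.simps monoid.simps by (intro sum.cong) auto
      then show "(f \<otimes>\<^bsub>?A\<^esub> \<one>\<^bsub>?A\<^esub>) w = f w" by simp
    qed
  qed
qed (simp_all add: free_algebra_def sum.distrib algebra_simps)

section \<open>Sums of left ideals and the left socle\<close>

definition left_ideal :: "'b set \<Rightarrow> 'b ring \<Rightarrow> bool" where
  "left_ideal I B \<longleftrightarrow> additive_subgroup I B \<and> (\<forall>b\<in>carrier B. \<forall>x\<in>I. b \<otimes>\<^bsub>B\<^esub> x \<in> I)"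

definition minimal_left_ideal :: "'b set \<Rightarrow> 'b ring \<Rightarrow> bool" where
  "minimal_left_ideal I B \<longleftrightarrow> left_ideal I B \<and> I \<noteq> {\<zero>\<^bsub>B\<^esub>} \<and>
    (\<forall>J. left_ideal J B \<longrightarrow> J \<subseteq> I \<longrightarrow> J = {\<zero>\<^bsub>B\<^esub>} \<or> J = I)"

text \<open>The sum of the (possibly infinite, possibly empty) family \<open>(I k)\<close>, \<open>k\<close> in \<open>K\<close>.\<close>

definition sum_left_ideals :: "'b ring \<Rightarrow> 'k set \<Rightarrow> ('k \<Rightarrow> 'b set) \<Rightarrow> 'b set" where
  "sum_left_ideals B K I =
    {\<Oplus>\<^bsub>B\<^esub>k\<in>F. x k | F x. finite F \<and> F \<subseteq> K \<and> (\<forall>k\<in>F. x k \<in> I k)}"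

definition left_socle :: "'b ring \<Rightarrow> 'b set" where
  "left_socle B = sum_left_ideals B {I. minimal_left_ideal I B} (\<lambda>I. I)"

section \<open>Subshifts\<close>

text \<open>
  The (nonempty) alphabet is the type \<open>'a\<close>; sequences and words are \<open>'a word\<close> (functions on
  the naturals) and \<open>'a list\<close>.
\<close>

definition occurs :: "'a list \<Rightarrow> 'a word \<Rightarrow> bool" where
  "occurs w x \<longleftrightarrow> (\<exists>i. x [i \<rightarrow> i + length w] = w)"

definition subshift :: "'a word set \<Rightarrow> bool" where
  "subshift X \<longleftrightarrow> (\<exists>F. X = {x. \<forall>w\<in>F. \<not> occurs w x})"

text \<open>The empty word belongs to the language even if \<open>X\<close> is empty.\<close>

definition lang :: "'a word set \<Rightarrow> 'a list set" where
  "lang X = insert [] {w. \<exists>x\<in>X. occurs w x}"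

definition \<C> :: "'a word set \<Rightarrow> 'a list \<Rightarrow> 'a list \<Rightarrow> 'a word set" where
  "\<C> X \<alpha> \<beta> = {\<beta> \<frown> x | x. \<beta> \<frown> x \<in> X \<and> \<alpha> \<frown> x \<in> X}"

inductive_set \<U> :: "'a word set \<Rightarrow> 'a word set set" for X where
  gen: "\<alpha> \<in> lang X \<Longrightarrow> \<beta> \<in> lang X \<Longrightarrow> \<C> X \<alpha> \<beta> \<in> \<U> X"
| union: "A \<in> \<U> X \<Longrightarrow> B \<in> \<U> X \<Longrightarrow> A \<union> B \<in> \<U> X"
| inter: "A \<in> \<U> X \<Longrightarrow> B \<in> \<U> X \<Longrightarrow> A \<inter> B \<in> \<U> X"
| compl: "A \<in> \<U> X \<Longrightarrow> X - A \<in> \<U> X"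

definition \<Q> :: "'a word set \<Rightarrow> 'a word set set" where
  "\<Q> X = {{p} | p. {p} \<in> \<U> X \<and>
    (\<forall>\<alpha>\<in>lang X. \<forall>\<beta>\<in>lang X. \<beta> \<noteq> [] \<longrightarrow> p \<noteq> \<alpha> \<frown> \<beta>\<^sup>\<omega>)}"

section \<open>The unital subshift algebra\<close>

datatype 'a generator = Gen_p "'a word set" | Gen_s 'a | Gen_s_star 'a

definition generators :: "'a word set \<Rightarrow> 'a generator set" where
  "generators X = Gen_p ` \<U> X \<union> range Gen_s \<union> range Gen_s_star"

definition s_word :: "'a list \<Rightarrow> 'a generator list" where
  "s_word \<alpha> = map Gen_s \<alpha>"

definition sstar_word :: "'a list \<Rightarrow> 'a generator list" where
  "sstar_word \<alpha> = map Gen_s_star (rev \<alpha>)"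

inductive_set relations ::
    "'a word set \<Rightarrow> (('a generator list \<Rightarrow> 'r::comm_ring_1) \<times> ('a generator list \<Rightarrow> 'r)) set"
  for X where
  unit: "(monomial [Gen_p X], monomial []) \<in> relations X"
| meet: "A \<in> \<U> X \<Longrightarrow> B \<in> \<U> X \<Longrightarrow>
    (monomial [Gen_p (A \<inter> B)], monomial [Gen_p A, Gen_p B]) \<in> relations X"
| join: "A \<in> \<U> X \<Longrightarrow> B \<in> \<U> X \<Longrightarrow>
    (monomial [Gen_p (A \<union> B)],
     \<lambda>w. monomial [Gen_p A] w + monomial [Gen_p B] w - monomial [Gen_p (A \<inter> B)] w) \<in> relations X"
| zero: "(monomial [Gen_p {}], \<lambda>w. 0) \<in> relations X"
| s: "(monomial [Gen_s a, Gen_s_star a, Gen_s a], monomial [Gen_s a]) \<in> relations X"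
| sstar: "(monomial [Gen_s_star a, Gen_s a, Gen_s_star a], monomial [Gen_s_star a]) \<in> relations X"
| cyl: "\<alpha> \<in> lang X \<Longrightarrow> \<beta> \<in> lang X \<Longrightarrow>
    (monomial (s_word \<beta> @ sstar_word \<alpha> @ s_word \<alpha> @ sstar_word \<beta>),
     monomial [Gen_p (\<C> X \<alpha> \<beta>)]) \<in> relations X"

text \<open>
  Letters not in \<open>lang X\<close> still contribute generators, and these are subject to the two
  von Neumann relations only: the last clause of \<open>relations\<close> does not mention them.
\<close>

text \<open>The argument of type \<^typ>\<open>'r itself\<close> is the ring of coefficients.\<close>

definition subshift_algebra ::
  "'r::comm_ring_1 itself \<Rightarrow> 'a word set \<Rightarrow> ('a generator list \<Rightarrow> 'r) set ring" where
  "subshift_algebra R X = presented_algebra (generators X) (relations X)"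

definition p_elem :: "'r::comm_ring_1 itself \<Rightarrow> 'a word set \<Rightarrow> 'a word set \<Rightarrow>
    ('a generator list \<Rightarrow> 'r) set" where
  "p_elem R X A =
    relation_ideal (generators X) (relations X) +>\<^bsub>free_algebra (generators X)\<^esub> monomial [Gen_p A]"

end

theory Submission
  imports Defs "HOL-Computational_Algebra.Polynomial_FPS"
begin

text \<open>
  By the commutation rules \<open>p\<^sub>A s\<^sub>\<alpha> = s\<^sub>\<alpha> p\<^bsub>{x. \<alpha>x \<in> A}\<^esub>\<close> and their adjoints, every element is a
  combination of monomials \<open>s\<^sub>\<alpha> p\<^sub>A s\<^sub>\<beta>\<^sup>*\<close>, and every nonzero left ideal contains an element
  \<open>y = p\<^sub>A (\<Sum>\<beta>\<in>W. c\<^sub>\<beta> s\<^sub>\<beta>\<^sup>*)\<close> with \<open>A \<noteq> {}\<close>, \<open>W\<close> finite, all \<open>c\<^sub>\<beta> \<noteq> 0\<close> and \<open>\<beta>x \<in> X\<close> for all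
  \<open>x \<in> A\<close>, \<open>\<beta> \<in> W\<close>. The algebra acts on the functions from \<open>X\<close> to the power series ring \<open>R[[h]]\<close>
  by \<open>(s\<^sub>a\<^sup>* \<phi>)(x) = (1 + h) \<phi>(ax)\<close>, where \<open>1 + h\<close> is a unit that is transcendental over \<open>R\<close>;
  hence such a \<open>y\<close> acts nontrivially on the indicator function of a single point.

  Let \<open>y\<close> lie in a minimal left ideal. If \<open>A\<close> were infinite, cutting it down would give a nonzero
  \<open>z\<close> in the ideal that kills an indicator function not killed by \<open>y\<close>, although \<open>y\<close> is a left
  multiple of \<open>z\<close>. So one may take \<open>A = {q}\<close>. If \<open>q\<close> were eventually periodic, one could
  arrange \<open>q = \<gamma>\<^sup>\<omega>\<close>; then \<open>y\<close> is a left multiple of \<open>(1 - s\<^sub>\<gamma>\<^sup>*) y\<close>, and evaluating at \<open>q\<close> shows that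
  \<open>1 - (1 + h)\<^sup>m\<close>, \<open>m\<close> the length of \<open>\<gamma>\<close>, divides \<open>1\<close> in \<open>R[[h]]\<close>, which is absurd. So \<open>{q} \<in> \<Q> X\<close>,
  and moving \<open>p\<^bsub>{q}\<^esub>\<close> to the right of each \<open>s\<^sub>\<beta>\<^sup>*\<close> places \<open>y\<close> in the sum of the ideals generated
  by the \<open>p\<^sub>A\<close>, \<open>A \<in> \<Q> X\<close>. Conversely, for \<open>{q} \<in> \<Q> X\<close> the reduction applied to a nonzero multiple
  of \<open>p\<^bsub>{q}\<^esub>\<close> leaves a single word \<open>\<beta>\<close> and a single point, since \<open>\<beta>x = \<beta>'x\<close> with \<open>\<beta> \<noteq> \<beta>'\<close> forces
  periodicity, and so recovers \<open>p\<^bsub>{q}\<^esub>\<close>.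
\<close>

section \<open>The Boolean algebra of a subshift\<close>

text \<open>These describe how projections change when moved across words: \<open>pull\<close> when
  \<open>p A\<close> passes to the right of \<open>S \<alpha>\<close> or to the left of
  \<open>T \<alpha>\<close>, \<open>push\<close> when it passes to the right of
  \<open>T \<alpha>\<close>.\<close>

definition pull :: "'a list \<Rightarrow> 'a word set \<Rightarrow> 'a word set" where
  "pull \<alpha> A = {x. \<alpha> \<frown> x \<in> A}"

definition push :: "'a word set \<Rightarrow> 'a list \<Rightarrow> 'a word set \<Rightarrow> 'a word set" where
  "push X \<alpha> A = {\<alpha> \<frown> x | x. x \<in> A \<and> \<alpha> \<frown> x \<in> X}"

lemma pull_Nil [simp]: "pull [] A = A"
  by (simp add: pull_def)

lemma pull_append: "pull (\<alpha> @ \<beta>) A = pull \<beta> (pull \<alpha> A)"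
  by (simp add: pull_def)

lemma pull_Int: "pull \<alpha> (A \<inter> D) = pull \<alpha> A \<inter> pull \<alpha> D"
  by (auto simp: pull_def)

lemma pull_push: "pull \<alpha> (push X \<alpha> A) = A \<inter> pull \<alpha> X"
  by (auto simp: pull_def push_def)

section \<open>Languages of subshifts and periodic sequences\<close>

lemma occurs_conc: "occurs w x \<Longrightarrow> occurs w (\<alpha> \<frown> x)"
proof -
  assume "occurs w x"
  then obtain i where "x [i \<rightarrow> i + length w] = w"
    by (auto simp: occurs_def)
  moreover have "(\<alpha> \<frown> x) [length \<alpha> + i \<rightarrow> length \<alpha> + i + length w] = x [i \<rightarrow> i + length w]"
    by (metis add.assoc subsequence_shift suffix_conc_length)
  ultimately show ?thesis
    unfolding occurs_def by metis
qed

lemma subshift_suffix_closed: "subshift X \<Longrightarrow> \<alpha> \<frown> x \<in> X \<Longrightarrow> x \<in> X"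
  using occurs_conc by (fastforce simp: subshift_def)

lemma lang_infix: "\<alpha> \<frown> \<beta> \<frown> x \<in> X \<Longrightarrow> \<beta> \<in> lang X"
proof -
  have "occurs \<beta> (\<beta> \<frown> x)"
    unfolding occurs_def by (rule exI[of _ 0]) simp
  then have "occurs \<beta> (\<alpha> \<frown> \<beta> \<frown> x)"
    by (rule occurs_conc)
  moreover assume "\<alpha> \<frown> \<beta> \<frown> x \<in> X"
  ultimately show "\<beta> \<in> lang X"
    by (auto simp: lang_def)
qed

lemma lang_prefix: "\<beta> \<frown> x \<in> X \<Longrightarrow> \<beta> \<in> lang X"
  using lang_infix[of "[]"] by simp

text \<open>The sequence has period \<open>length \<gamma>\<close>, so strong induction steps back
  by one period until the index falls inside \<open>\<gamma>\<close>.\<close>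

lemma iter_eqI:
  assumes "\<gamma> \<frown> x = x" "\<gamma> \<noteq> []"
  shows "x = \<gamma>\<^sup>\<omega>"
proof
  fix n
  show "x n = \<gamma>\<^sup>\<omega> n"
  proof (induction n rule: less_induct)
    case (less n)
    have n: "x n = (\<gamma> \<frown> x) n" using assms by simp
    show ?case
    proof (cases "n < length \<gamma>")
      case True
      then have "x n = \<gamma> ! n" using n by (simp only: conc_fst)
      then show ?thesis using True assms by simp
    next
      case False
      then have "x n = x (n - length \<gamma>)" using n False by (metis conc_snd)
      also have "\<dots> = \<gamma>\<^sup>\<omega> (n - length \<gamma>)" using less[of "n - length \<gamma>"] False assms by (cases \<gamma>) auto
      also have "\<dots> = \<gamma>\<^sup>\<omega> n"
        using False assms by (simp add: le_mod_geq)
      finally show ?thesis .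
    qed
  qed
qed

text \<open>Words of equal length would coincide, so one is a proper prefix of the other, and the
  surplus \<open>\<gamma>\<close> satisfies \<open>\<gamma> \<frown> x = x\<close>. Through this
  lemma the aperiodicity of a point enters the minimality of its ideal.\<close>

lemma conc_eq_conc_imp_periodic:
  assumes "\<beta> \<frown> x = \<beta>' \<frown> x" "\<beta> \<noteq> \<beta>'"
  shows "\<exists>\<delta> \<gamma>. \<gamma> \<noteq> [] \<and> \<beta> \<frown> x = \<delta> \<frown> \<gamma>\<^sup>\<omega>"
proof -
  have *: "\<exists>\<delta> \<gamma>. \<gamma> \<noteq> [] \<and> \<beta> \<frown> x = \<delta> \<frown> \<gamma>\<^sup>\<omega>"
    if "length \<beta> < length \<beta>'" "\<beta> \<frown> x = \<beta>' \<frown> x" for \<beta> \<beta>' :: "'a list"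
  proof -
    define \<gamma> where "\<gamma> = drop (length \<beta>) \<beta>'"
    have "\<beta>' \<frown> x = take (length \<beta>) \<beta>' \<frown> \<gamma> \<frown> x"
      unfolding \<gamma>_def conc_conc by simp
    with that have "\<beta> = take (length \<beta>) \<beta>' \<and> x = \<gamma> \<frown> x"
      using concat_eq[of \<beta> "take (length \<beta>) \<beta>'" x "\<gamma> \<frown> x"] by (simp del: conc_conc)
    moreover have "\<gamma> \<noteq> []"
      using that by (simp add: \<gamma>_def)
    ultimately show ?thesis
      using iter_eqI[of \<gamma> x] by auto
  qed
  consider "length \<beta> < length \<beta>'" | "length \<beta>' < length \<beta>" | "length \<beta> = length \<beta>'"
    by linarith
  then show ?thesis
    using *[of \<beta> \<beta>'] *[of \<beta>' \<beta>] assms by cases auto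
qed

lemma Nil_lang [simp]: "[] \<in> lang X"
  by (simp add: lang_def)

lemma U_subset: "A \<in> \<U> X \<Longrightarrow> A \<subseteq> X"
  by (induction rule: \<U>.induct) (auto simp: \<C>_def)

lemma U_X [simp]: "X \<in> \<U> X"
  using \<U>.gen[of "[]" X "[]"] by (simp add: \<C>_def)

lemma U_empty [simp]: "{} \<in> \<U> X"
  using \<U>.compl[OF U_X] by simp

text \<open>\<open>letter_lang\<close> makes relation (iii) available for every letter; on a letter
  outside the language only the two von Neumann relations are imposed, and these do not tie
  \<open>s a\<close> and \<open>t a\<close> to projections.\<close>

locale shift_space =
  fixes X :: "'a word set"
  assumes suffix_closed: "\<alpha> \<frown> x \<in> X \<Longrightarrow> x \<in> X"
    and letter_lang: "[a] \<in> lang X"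
begin

lemma build_closed: "a ## x \<in> X \<Longrightarrow> x \<in> X"
  using suffix_closed[of "[a]" x] by simp

lemma U_Int [simp]: "A \<in> \<U> X \<Longrightarrow> D \<in> \<U> X \<Longrightarrow> A \<inter> D \<in> \<U> X"
  by (rule \<U>.inter)

lemma U_diff [simp]: "A \<in> \<U> X \<Longrightarrow> D \<in> \<U> X \<Longrightarrow> A - D \<in> \<U> X"
  using \<U>.inter[of A X "X - D"] \<U>.compl[of D X] U_subset[of A]
  by (simp add: Int_Diff[symmetric] Int_absorb2)

section \<open>Closure of the Boolean algebra under adding and removing prefixes\<close>

lemma C_push: "\<C> X \<alpha> \<beta> = push X \<beta> (pull \<alpha> X)"
  by (auto simp: \<C>_def push_def pull_def)

lemma C_empty: "\<alpha> \<notin> lang X \<or> \<beta> \<notin> lang X \<Longrightarrow> \<C> X \<alpha> \<beta> = {}"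
  using lang_prefix by (auto simp: \<C>_def)

text \<open>Outside the language the set is empty, so inductions that lengthen words need no side
  condition.\<close>

lemma U_C [simp]: "\<C> X \<alpha> \<beta> \<in> \<U> X"
  using \<U>.gen[of \<alpha> X \<beta>] C_empty[of \<alpha> \<beta>] U_empty by (cases "\<alpha> \<in> lang X \<and> \<beta> \<in> lang X") auto

lemma C_Nil: "\<C> X \<alpha> [] = pull \<alpha> X"
  using suffix_closed by (auto simp: C_push push_def pull_def)

lemma U_pull_X [simp]: "pull \<alpha> X \<in> \<U> X"
  using U_C[of \<alpha> "[]"] C_Nil[of \<alpha>] by simp

text \<open>Base case for the closure under \<open>pull\<close>: removing a letter turns a
  generating set into another one, an intersection of two, or the empty set.\<close>

lemma pull_C:
  "pull [a] (\<C> X \<alpha> []) = \<C> X (\<alpha> @ [a]) []"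
  "pull [a] (\<C> X \<alpha> (a # \<beta>)) = pull [a] X \<inter> \<C> X \<alpha> \<beta>"
  "a \<noteq> b \<Longrightarrow> pull [a] (\<C> X \<alpha> (b # \<beta>)) = {}"
  using build_closed by (auto simp: C_Nil pull_append)
    (auto simp: pull_def \<C>_def)

lemma U_pull_letter: "A \<in> \<U> X \<Longrightarrow> pull [a] A \<in> \<U> X"
proof (induction rule: \<U>.induct)
  case (gen \<alpha> \<beta>)
  show ?case
    by (cases \<beta>; cases "hd \<beta> = a") (auto simp: pull_C)
next
  case (union A D)
  then show ?case using \<U>.union[of "pull [a] A" X "pull [a] D"]
    by (simp add: pull_def Collect_disj_eq)
next
  case (compl A)
  have "pull [a] (X - A) = pull [a] X - pull [a] A" by (auto simp: pull_def)
  then show ?case using compl by simp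
qed (simp add: pull_Int)

lemma U_pull [simp]: "A \<in> \<U> X \<Longrightarrow> pull \<alpha> A \<in> \<U> X"
proof (induction \<alpha> arbitrary: A)
  case (Cons a \<alpha>)
  then show ?case using pull_append[of "[a]" \<alpha> A] U_pull_letter by simp
qed simp

text \<open>Prefixing is injective, so \<open>push\<close> commutes with unions, intersections and
  complements, the last taken inside the cylinder \<open>\<C> X [] \<alpha>\<close>.\<close>

lemma U_push [simp]: "A \<in> \<U> X \<Longrightarrow> push X \<alpha> A \<in> \<U> X"
proof (induction rule: \<U>.induct)
  case (gen \<gamma> \<beta>)
  have "push X \<alpha> (\<C> X \<gamma> \<beta>) = \<C> X \<gamma> (\<alpha> @ \<beta>)"
    using suffix_closed by (auto simp: push_def \<C>_def) (metis conc_conc)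
  then show ?case by simp
next
  case (union A D)
  moreover have "push X \<alpha> (A \<union> D) = push X \<alpha> A \<union> push X \<alpha> D" by (auto simp: push_def)
  ultimately show ?case by (simp add: \<U>.union)
next
  case (inter A D)
  moreover have "push X \<alpha> (A \<inter> D) = push X \<alpha> A \<inter> push X \<alpha> D" by (auto simp: push_def)
  ultimately show ?case by simp
next
  case (compl A)
  have "push X \<alpha> (X - A) = \<C> X [] \<alpha> - push X \<alpha> A"
    using suffix_closed by (auto simp: push_def \<C>_def)
  then show ?case using compl by simp
qed

lemma push_singleton: "\<alpha> \<frown> x \<in> X \<Longrightarrow> push X \<alpha> {x} = {\<alpha> \<frown> x}"
  by (auto simp: push_def)

text \<open>Distinct sequences differ at some index \<open>n\<close>, and the cylinder on the first
  \<open>Suc n\<close> letters of \<open>q\<close> excludes the other point; finitely many points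
  are excluded one after another.\<close>

lemma separation:
  assumes "finite P" "q \<in> X" "q \<notin> P"
  shows "\<exists>D\<in>\<U> X. q \<in> D \<and> D \<inter> P = {}"
  using assms
proof (induction P)
  case (insert x P)
  then obtain D where D: "D \<in> \<U> X" "q \<in> D" "D \<inter> P = {}" by auto
  obtain n where n: "x n \<noteq> q n" using insert.prems by fastforce
  define E where "E = \<C> X [] (prefix (Suc n) q)"
  have "q \<in> E" 
    using insert suffix_closed[of "prefix (Suc n) q" "suffix (Suc n) q"]
    by (auto simp: E_def \<C>_def simp del: subseq_to_Suc intro!: exI[of _ "suffix (Suc n) q"])
  moreover have "x \<notin> E"
    using n by (auto simp: E_def \<C>_def conc_def simp del: subseq_to_Suc)
  ultimately show ?case
    using D by (intro bexI[of _ "D \<inter> E"]) (auto simp: E_def)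
qed auto

lemma singleton_U:
  assumes "finite A" "A \<in> \<U> X" "q \<in> A"
  shows "{q} \<in> \<U> X"
proof -
  obtain D where "D \<in> \<U> X" "q \<in> D" "D \<inter> (A - {q}) = {}"
    using separation[of "A - {q}" q] assms U_subset by auto
  then have "{q} = A \<inter> D" "A \<inter> D \<in> \<U> X" using assms by auto
  then show ?thesis by simp
qed

end

section \<open>Principal left ideals and sums of left ideals\<close>

text \<open>\<open>left_ideal\<close> and \<open>left_socle\<close> are defined for ring records without further fields only.\<close>

locale plain_ring = ring R for R :: "'b ring" (structure)

lemma left_ideal_subset: "left_ideal I B \<Longrightarrow> I \<subseteq> carrier B"
  by (simp add: left_ideal_def additive_subgroup.a_subset)

lemma (in plain_ring) left_ideal_principal:
  assumes "z \<in> carrier R"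
  shows "left_ideal {b \<otimes> z | b. b \<in> carrier R} R"
proof -
  let ?I = "{b \<otimes> z | b. b \<in> carrier R}"
  have "subgroup ?I (add_monoid R)"
  proof (rule add.subgroupI)
    show "?I \<subseteq> carrier R" "?I \<noteq> {}" using assms by auto
  next
    fix x assume "x \<in> ?I"
    then obtain b where "b \<in> carrier R" "x = b \<otimes> z" by auto
    then show "\<ominus> x \<in> ?I" using assms by (auto intro!: exI[of _ "\<ominus> b"] simp: l_minus)
  next
    fix x y assume "x \<in> ?I" "y \<in> ?I"
    then obtain b c where "b \<in> carrier R" "x = b \<otimes> z" "c \<in> carrier R" "y = c \<otimes> z" by auto
    then show "x \<oplus> y \<in> ?I" using assms by (auto intro!: exI[of _ "b \<oplus> c"] simp: l_distr)
  qed
  moreover have "b \<otimes> x \<in> ?I" if "b \<in> carrier R" "x \<in> ?I" for b x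
    using that assms by (auto simp: m_assoc[symmetric])
  ultimately show ?thesis
    by (auto simp: left_ideal_def additive_subgroup_def)
qed

text \<open>The multiples of \<open>z\<close> form a nonzero left ideal inside
  \<open>I\<close>.\<close>

lemma (in plain_ring) minimal_left_ideal_cyclic:
  assumes "minimal_left_ideal I R" "z \<in> I" "z \<noteq> \<zero>"
  shows "I = {b \<otimes> z | b. b \<in> carrier R}"
proof -
  let ?J = "{b \<otimes> z | b. b \<in> carrier R}"
  have I: "left_ideal I R" using assms by (simp add: minimal_left_ideal_def)
  have z: "z \<in> carrier R" using left_ideal_subset[OF I] assms by auto
  have "z \<in> ?J" using z by (auto intro!: exI[of _ \<one>])
  moreover have "left_ideal ?J R" "?J \<subseteq> I"
    using left_ideal_principal[OF z] I assms by (auto simp: left_ideal_def)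
  ultimately show ?thesis
    using assms unfolding minimal_left_ideal_def by blast
qed

context plain_ring
begin

lemma sum_left_ideals_mem:
  "i \<in> K \<Longrightarrow> x \<in> I i \<Longrightarrow> x \<in> carrier R \<Longrightarrow> x \<in> sum_left_ideals R K I"
  unfolding sum_left_ideals_def
  by (intro CollectI exI[of _ "{i}"] exI[of _ "\<lambda>_. x"]) simp

lemma sum_left_ideals_zero: "\<zero> \<in> sum_left_ideals R K I"
  unfolding sum_left_ideals_def by (intro CollectI exI[of _ "{}"]) simp

lemma sum_left_ideals_add:
  assumes I: "\<And>i. i \<in> K \<Longrightarrow> left_ideal (I i) R"
    and "x \<in> sum_left_ideals R K I" "y \<in> sum_left_ideals R K I"
  shows "x \<oplus> y \<in> sum_left_ideals R K I"
proof -
  obtain F f where f: "x = (\<Oplus>i\<in>F. f i)" "finite F" "F \<subseteq> K" "\<forall>i\<in>F. f i \<in> I i"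
    using assms(2) by (auto simp: sum_left_ideals_def)
  obtain G g where g: "y = (\<Oplus>i\<in>G. g i)" "finite G" "G \<subseteq> K" "\<forall>i\<in>G. g i \<in> I i"
    using assms(3) by (auto simp: sum_left_ideals_def)
  \<comment> \<open>The two families have different index sets; both are extended by zero to
    \<open>F \<union> G\<close>.\<close>
  define f' g' where "f' i = (if i \<in> F then f i else \<zero>)" and "g' i = (if i \<in> G then g i else \<zero>)" for i
  have sub: "additive_subgroup (I i) R" if "i \<in> K" for i
    using I[OF that] by (simp add: left_ideal_def)
  have mem: "f' i \<in> I i" "g' i \<in> I i" if "i \<in> F \<union> G" for i
    using that f g sub[of i] by (auto simp: f'_def g'_def intro!: additive_subgroup.zero_closed)
  have car: "f' \<in> F \<union> G \<rightarrow> carrier R" "g' \<in> F \<union> G \<rightarrow> carrier R"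
    using mem f g left_ideal_subset[OF I] by blast+
  have car': "f i \<in> carrier R" if "i \<in> F" for i
    using that f left_ideal_subset[OF I] by blast
  have car'': "g i \<in> carrier R" if "i \<in> G" for i
    using that g left_ideal_subset[OF I] by blast
  have "x = (\<Oplus>i\<in>F \<union> G. f' i)"
    unfolding f(1) using f g car by (intro add.finprod_mono_neutral_cong_left) (auto simp: f'_def car')
  moreover have "y = (\<Oplus>i\<in>F \<union> G. g' i)"
    unfolding g(1) using f g car by (intro add.finprod_mono_neutral_cong_left) (auto simp: g'_def car'')
  ultimately have "x \<oplus> y = (\<Oplus>i\<in>F \<union> G. f' i \<oplus> g' i)"
    using car by (simp add: finsum_addf)
  then show ?thesis
    unfolding sum_left_ideals_def using f g mem sub
    by (intro CollectI exI[of _ "F \<union> G"] exI[of _ "\<lambda>i. f' i \<oplus> g' i"])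
      (auto intro!: additive_subgroup.a_closed)
qed

lemma sum_left_ideals_mult:
  assumes I: "\<And>i. i \<in> K \<Longrightarrow> left_ideal (I i) R" and "x \<in> sum_left_ideals R K I" "b \<in> carrier R"
  shows "b \<otimes> x \<in> sum_left_ideals R K I"
proof -
  obtain F f where f: "x = (\<Oplus>i\<in>F. f i)" "finite F" "F \<subseteq> K" "\<forall>i\<in>F. f i \<in> I i"
    using assms(2) by (auto simp: sum_left_ideals_def)
  have "f \<in> F \<rightarrow> carrier R" using f left_ideal_subset[OF I] by blast
  then have "b \<otimes> x = (\<Oplus>i\<in>F. b \<otimes> f i)"
    using f assms by (simp add: finsum_rdistr)
  moreover have "\<forall>i\<in>F. b \<otimes> f i \<in> I i" using I f assms by (auto simp: left_ideal_def)
  ultimately show ?thesis using f unfolding sum_left_ideals_def by blast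
qed

lemma sum_left_ideals_least:
  assumes "\<And>i x. i \<in> K \<Longrightarrow> x \<in> I i \<Longrightarrow> x \<in> J" "\<zero> \<in> J" "J \<subseteq> carrier R"
    and add: "\<And>x y. x \<in> J \<Longrightarrow> y \<in> J \<Longrightarrow> x \<oplus> y \<in> J"
  shows "sum_left_ideals R K I \<subseteq> J"
proof -
  have "(\<Oplus>i\<in>F. f i) \<in> J" if "finite F" "F \<subseteq> K" "\<forall>i\<in>F. f i \<in> I i" for F f
    using that
  proof (induction F)
    case (insert i F)
    then have "f \<in> F \<rightarrow> carrier R" "f i \<in> carrier R" using assms by blast+
    moreover have "f i \<in> J" "finsum R f F \<in> J" using insert assms(1)[of i "f i"] by auto
    ultimately show ?case using insert.hyps add by simp
  qed (use assms in simp)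
  then show ?thesis by (auto simp: sum_left_ideals_def)
qed

lemma sum_left_ideals_closed:
  assumes "\<And>i. i \<in> K \<Longrightarrow> left_ideal (I i) R"
  shows "sum_left_ideals R K I \<subseteq> carrier R"
  using assms left_ideal_subset by (intro sum_left_ideals_least) auto

end

section \<open>Commutation rules in the subshift algebra\<close>

lemma occurs_ConsD: "occurs (a # w) x \<Longrightarrow> occurs w x"
proof -
  assume "occurs (a # w) x"
  then obtain i where "x [i \<rightarrow> i + length (a # w)] = a # w" by (auto simp: occurs_def)
  then have "map x [i..<i + Suc (length w)] = a # w" by (simp add: subsequence_def)
  then have "map x [Suc i..<Suc i + length w] = w" by (simp add: upt_conv_Cons del: upt_Suc)
  then show ?thesis unfolding occurs_def subsequence_def by blast
qed

lemma lang_ConsD: "a # w \<in> lang X \<Longrightarrow> w \<in> lang X"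
  using occurs_ConsD by (fastforce simp: lang_def)

text \<open>An ordered product, as the factors do not commute; the empty list gives the convention
  that the empty word stands for 1.\<close>

primrec lprod :: "('b, 'm) monoid_scheme \<Rightarrow> 'b list \<Rightarrow> 'b" where
  "lprod B [] = \<one>\<^bsub>B\<^esub>"
| "lprod B (x # xs) = x \<otimes>\<^bsub>B\<^esub> lprod B xs"

lemma (in monoid) lprod_closed [simp]: "set xs \<subseteq> carrier G \<Longrightarrow> lprod G xs \<in> carrier G"
  by (induction xs) auto

lemma (in monoid) lprod_append:
  "set xs \<subseteq> carrier G \<Longrightarrow> set ys \<subseteq> carrier G \<Longrightarrow> lprod G (xs @ ys) = lprod G xs \<otimes> lprod G ys"
  by (induction xs) (auto simp: m_assoc)

text \<open>The algebra seen abstractly: a ring with a central image \<open>k\<close> of the field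
  and elements subject to the defining relations. \<open>generated\<close> has the form of an
  induction rule with left multiplication by generators, which is how \<open>Comb\<close> is shown
  to exhaust the ring.\<close>

locale subshift_ring = plain_ring B + shift_space X
  for B :: "'b ring" (structure) and X :: "'a word set" +
  fixes k :: "'r::field \<Rightarrow> 'b" and p :: "'a word set \<Rightarrow> 'b" and s t :: "'a \<Rightarrow> 'b"
  assumes k_closed [simp]: "k r \<in> carrier B"
    and k_add: "k (r + r') = k r \<oplus> k r'"
    and k_mult: "k (r * r') = k r \<otimes> k r'"
    and k_1 [simp]: "k 1 = \<one>"
    and k_comm: "x \<in> carrier B \<Longrightarrow> x \<otimes> k r = k r \<otimes> x"
    and p_closed [simp]: "A \<in> \<U> X \<Longrightarrow> p A \<in> carrier B"
    and s_closed [simp]: "s a \<in> carrier B"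
    and t_closed [simp]: "t a \<in> carrier B"
    and p_X [simp]: "p X = \<one>"
    and p_empty [simp]: "p {} = \<zero>"
    and p_Int: "A \<in> \<U> X \<Longrightarrow> D \<in> \<U> X \<Longrightarrow> p (A \<inter> D) = p A \<otimes> p D"
    and p_Un: "A \<in> \<U> X \<Longrightarrow> D \<in> \<U> X \<Longrightarrow> p (A \<union> D) = p A \<oplus> p D \<ominus> p (A \<inter> D)"
    and s_t_s: "s a \<otimes> t a \<otimes> s a = s a"
    and t_s_t: "t a \<otimes> s a \<otimes> t a = t a"
    and p_C: "\<alpha> \<in> lang X \<Longrightarrow> \<beta> \<in> lang X \<Longrightarrow>
      lprod B (map s \<beta>) \<otimes> lprod B (map t (rev \<alpha>)) \<otimes> lprod B (map s \<alpha>) \<otimes>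
        lprod B (map t (rev \<beta>)) = p (\<C> X \<alpha> \<beta>)"
    and generated: "\<lbrakk>Z \<subseteq> carrier B; \<one> \<in> Z; \<And>x y. x \<in> Z \<Longrightarrow> y \<in> Z \<Longrightarrow> x \<oplus> y \<in> Z;
      \<And>r x. x \<in> Z \<Longrightarrow> k r \<otimes> x \<in> Z; \<And>A x. A \<in> \<U> X \<Longrightarrow> x \<in> Z \<Longrightarrow> p A \<otimes> x \<in> Z;
      \<And>a x. x \<in> Z \<Longrightarrow> s a \<otimes> x \<in> Z; \<And>a x. x \<in> Z \<Longrightarrow> t a \<otimes> x \<in> Z\<rbrakk> \<Longrightarrow> Z = carrier B"
begin

abbreviation S :: "'a list \<Rightarrow> 'b" where "S \<alpha> \<equiv> lprod B (map s \<alpha>)"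

abbreviation T :: "'a list \<Rightarrow> 'b" where "T \<alpha> \<equiv> lprod B (map t (rev \<alpha>))"

lemma S_closed [simp]: "S \<alpha> \<in> carrier B"
  by (rule lprod_closed) auto

lemma T_closed [simp]: "T \<alpha> \<in> carrier B"
  by (rule lprod_closed) auto

lemma T_append: "T (\<alpha> @ \<beta>) = T \<beta> \<otimes> T \<alpha>"
  unfolding rev_append map_append by (rule lprod_append) auto

lemma T_Cons: "T (a # \<alpha>) = T \<alpha> \<otimes> t a"
  using T_append[of "[a]" \<alpha>] by simp

lemma T_snoc: "T (\<alpha> @ [a]) = t a \<otimes> T \<alpha>"
  using T_append[of \<alpha> "[a]"] by simp

lemma S_snoc: "S (\<alpha> @ [a]) = S \<alpha> \<otimes> s a"
  using lprod_append[of "map s \<alpha>" "[s a]"] by (simp add: image_subset_iff)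

lemma p_commute: "A \<in> \<U> X \<Longrightarrow> D \<in> \<U> X \<Longrightarrow> p A \<otimes> p D = p D \<otimes> p A"
  by (metis p_Int Int_commute)

lemma p_mult [simp]: "A \<in> \<U> X \<Longrightarrow> D \<in> \<U> X \<Longrightarrow> p A \<otimes> p D = p (A \<inter> D)"
  by (simp add: p_Int)

lemma p_mult_left [simp]:
  "A \<in> \<U> X \<Longrightarrow> D \<in> \<U> X \<Longrightarrow> x \<in> carrier B \<Longrightarrow> p A \<otimes> (p D \<otimes> x) = p (A \<inter> D) \<otimes> x"
  by (simp add: m_assoc[symmetric])

lemma p_add: "A \<in> \<U> X \<Longrightarrow> D \<in> \<U> X \<Longrightarrow> p (A \<union> D) \<oplus> p (A \<inter> D) = p A \<oplus> p D"
  by (simp add: p_Un minus_eq a_assoc l_neg)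

lemma p_split: "A \<in> \<U> X \<Longrightarrow> D \<in> \<U> X \<Longrightarrow> p A = p (A \<inter> D) \<oplus> p (A - D)"
  using p_add[of "A \<inter> D" "A - D"] by (simp add: Int_Diff_Un Int_Diff_disjoint del: p_mult p_mult_left)

lemma p_Z: "p (\<C> X [] [a]) = s a \<otimes> t a"
  using p_C[of "[]" "[a]"] letter_lang by simp

lemma p_F_lang: "\<alpha> \<in> lang X \<Longrightarrow> p (pull \<alpha> X) = T \<alpha> \<otimes> S \<alpha>"
  using p_C[of \<alpha> "[]"] by (simp add: C_Nil)

lemma p_F_letter: "p (pull [a] X) = t a \<otimes> s a"
  using p_F_lang[of "[a]"] letter_lang by simp

text \<open>The product factors through \<open>s a \<otimes> t a\<close> and
  \<open>s b \<otimes> t b\<close>, which are the projections of disjoint cylinders.\<close>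

lemma t_s_distinct: "a \<noteq> b \<Longrightarrow> t a \<otimes> s b = \<zero>"
proof -
  assume "a \<noteq> b"
  then have *: "\<C> X [] [a] \<inter> \<C> X [] [b] = {}"
    by (auto simp: \<C>_def)
  have "t a \<otimes> s b = t a \<otimes> (p (\<C> X [] [a]) \<otimes> p (\<C> X [] [b])) \<otimes> s b"
  proof -
    have "t a \<otimes> s b = (t a \<otimes> s a \<otimes> t a) \<otimes> (s b \<otimes> t b \<otimes> s b)"
      by (simp only: s_t_s t_s_t)
    then show ?thesis by (simp add: p_Z m_assoc del: p_mult p_mult_left)
  qed
  also have "\<dots> = \<zero>"
    by (subst p_mult) (simp_all add: *)
  finally show ?thesis .
qed

lemma p_t_s_commute: "A \<in> \<U> X \<Longrightarrow> p A \<otimes> (s a \<otimes> t a) = (s a \<otimes> t a) \<otimes> p A"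
  using p_commute[of A "\<C> X [] [a]"] by (simp only: p_Z U_C)

lemma p_s_conv: "A \<in> \<U> X \<Longrightarrow> p A \<otimes> s a = s a \<otimes> (t a \<otimes> p A \<otimes> s a)"
proof -
  assume A: "A \<in> \<U> X"
  have "p A \<otimes> s a = p A \<otimes> (s a \<otimes> t a) \<otimes> s a"
    using A s_t_s[of a] by (simp add: m_assoc)
  then show ?thesis
    using A by (simp only: p_t_s_commute) (simp add: m_assoc)
qed

text \<open>All commutation rules rest on this. For generating sets it follows from relation (iii),
  case by case along \<open>pull_C\<close>; conjugation by \<open>t a\<close> and \<open>s a\<close>
  is multiplicative on projections and additive, which settles the Boolean operations.\<close>

lemma t_p_s: "A \<in> \<U> X \<Longrightarrow> t a \<otimes> p A \<otimes> s a = p (pull [a] A)"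
proof (induction rule: \<U>.induct)
  case (gen \<alpha> \<beta>)
  show ?case
  proof (cases \<beta>)
    case Nil
    show ?thesis
    proof (cases "\<alpha> @ [a] \<in> lang X")
      case True
      have "t a \<otimes> p (\<C> X \<alpha> []) \<otimes> s a = T (\<alpha> @ [a]) \<otimes> S (\<alpha> @ [a])"
        using p_F_lang[OF gen(1)] by (simp add: C_Nil T_snoc S_snoc m_assoc del: rev_append map_append)
      then show ?thesis
        using Nil p_F_lang[OF True] by (simp add: C_Nil pull_append)
    next
      case False
      \<comment> \<open>Relation (iii) says nothing about \<open>\<alpha> @ [a]\<close> here, but
        then no point of \<open>pull \<alpha> X\<close> starts with \<open>a\<close>, and both sides
        vanish.\<close>
      have *: "\<C> X [] [a] \<inter> pull \<alpha> X = {}" "pull [a] (\<C> X \<alpha> \<beta>) = {}"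
        using False lang_prefix[of "\<alpha> @ [a]"] by (auto simp: \<C>_def pull_def Nil)
      have "t a \<otimes> p (pull \<alpha> X) \<otimes> s a = t a \<otimes> (p (\<C> X [] [a]) \<otimes> p (pull \<alpha> X)) \<otimes> s a"
        using t_s_t[of a] by (simp add: p_Z m_assoc[symmetric] del: p_mult p_mult_left)
      also have "\<dots> = \<zero>"
        by (subst p_mult) (simp_all add: *)
      finally show ?thesis using * Nil by (simp add: C_Nil)
    qed
  next
    case (Cons b \<beta>')
    show ?thesis
    proof (cases "b = a")
      case True
      \<comment> \<open>The shortened word must lie in the language for relation (iii) to apply to
        it.\<close>
      have \<beta>': "\<beta>' \<in> lang X"
        using lang_ConsD[of b \<beta>' X] gen(2) unfolding Cons by simp
      have "p (\<C> X \<alpha> \<beta>) = s a \<otimes> (S \<beta>' \<otimes> T \<alpha> \<otimes> S \<alpha> \<otimes> T \<beta>') \<otimes> t a"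
        unfolding p_C[OF gen, symmetric] unfolding Cons True T_Cons by (simp add: m_assoc)
      then have "t a \<otimes> p (\<C> X \<alpha> \<beta>) \<otimes> s a =
          t a \<otimes> s a \<otimes> (S \<beta>' \<otimes> T \<alpha> \<otimes> S \<alpha> \<otimes> T \<beta>') \<otimes> (t a \<otimes> s a)"
        by (simp add: m_assoc)
      also have "\<dots> = p (pull [a] X) \<otimes> p (\<C> X \<alpha> \<beta>') \<otimes> p (pull [a] X)"
        by (simp only: p_C[OF gen(1) \<beta>'] p_F_letter)
      also have "\<dots> = p (pull [a] (\<C> X \<alpha> \<beta>))"
        unfolding Cons True pull_C by (simp add: Int_commute Int_left_commute)
      finally show ?thesis .
    next
      case False
      have "p (\<C> X \<alpha> \<beta>) = s b \<otimes> (S \<beta>' \<otimes> T \<alpha> \<otimes> S \<alpha> \<otimes> T \<beta>)"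
        unfolding p_C[OF gen, symmetric] unfolding Cons by (simp add: m_assoc del: rev.simps)
      then have "t a \<otimes> p (\<C> X \<alpha> \<beta>) \<otimes> s a =
          (t a \<otimes> s b) \<otimes> (S \<beta>' \<otimes> T \<alpha> \<otimes> S \<alpha> \<otimes> T \<beta> \<otimes> s a)"
        by (simp add: m_assoc del: rev.simps)
      also have "\<dots> = \<zero>"
        using False t_s_distinct[of a b] by (simp del: rev.simps)
      also have "\<dots> = p (pull [a] (\<C> X \<alpha> \<beta>))"
        using False by (simp add: Cons pull_C)
      finally show ?thesis .
    qed
  qed
next
  case (inter A D)
  have "t a \<otimes> p (A \<inter> D) \<otimes> s a = t a \<otimes> p A \<otimes> (p D \<otimes> s a)"
    using inter by (simp add: p_Int m_assoc del: p_mult p_mult_left)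
  \<comment> \<open>As \<open>s a \<otimes> t a\<close> commutes with projections,
    \<open>p D \<otimes> s a\<close> can be rewritten to begin with \<open>s a\<close>.\<close>
  also have "\<dots> = (t a \<otimes> p A \<otimes> s a) \<otimes> (t a \<otimes> p D \<otimes> s a)"
    using inter.hyps by (subst p_s_conv) (simp_all add: m_assoc del: p_mult p_mult_left)
  also have "\<dots> = p (pull [a] (A \<inter> D))"
    using inter by (simp only: inter.IH pull_Int p_Int U_pull)
  finally show ?case .
next
  case (union A D)
  \<comment> \<open>The induction hypotheses cover only \<open>A\<close> and \<open>D\<close>, so
    the value at the intersection is computed first.\<close>
  have "t a \<otimes> p (A \<inter> D) \<otimes> s a = t a \<otimes> p A \<otimes> (p D \<otimes> s a)"
    using union by (simp add: p_Int m_assoc del: p_mult p_mult_left)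
  also have "\<dots> = (t a \<otimes> p A \<otimes> s a) \<otimes> (t a \<otimes> p D \<otimes> s a)"
    using union.hyps by (subst p_s_conv) (simp_all add: m_assoc del: p_mult p_mult_left)
  finally have 1: "t a \<otimes> p (A \<inter> D) \<otimes> s a = p (pull [a] A \<inter> pull [a] D)"
    using union by (simp only: union.IH p_Int U_pull)
  have U: "A \<union> D \<in> \<U> X" "pull [a] A \<union> pull [a] D \<in> \<U> X"
    using union by (simp_all add: \<U>.union)
  have "t a \<otimes> p (A \<union> D) \<otimes> s a \<oplus> t a \<otimes> p (A \<inter> D) \<otimes> s a = t a \<otimes> (p (A \<union> D) \<oplus> p (A \<inter> D)) \<otimes> s a"
    using union U by (simp add: l_distr r_distr del: p_mult p_mult_left)
  also have "\<dots> = p (pull [a] A) \<oplus> p (pull [a] D)"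
    using union by (simp add: p_add l_distr r_distr union.IH)
  also have "\<dots> = p (pull [a] A \<union> pull [a] D) \<oplus> p (pull [a] A \<inter> pull [a] D)"
    using union by (simp add: p_add)
  finally have "t a \<otimes> p (A \<union> D) \<otimes> s a = p (pull [a] A \<union> pull [a] D)"
    using union U unfolding 1 by (simp add: add.right_cancel)
  then show ?case by (simp add: pull_def Collect_disj_eq)
next
  case (compl A)
  have A: "X \<inter> A = A" "pull [a] X \<inter> pull [a] A = pull [a] A"
    using U_subset[OF compl(1)] by (auto simp: pull_def)
  \<comment> \<open>Instead of subtracting, the contribution of \<open>A\<close> is added and
    cancelled at the end.\<close>
  have "t a \<otimes> p (X - A) \<otimes> s a \<oplus> p (pull [a] A) = t a \<otimes> (p (X - A) \<oplus> p A) \<otimes> s a"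
    using compl by (simp add: l_distr r_distr)
  also have "p (X - A) \<oplus> p A = p X"
    using p_split[of X A] compl by (simp add: A a_comm del: p_X)
  also have "t a \<otimes> p X \<otimes> s a = p (pull [a] X)"
    by (simp add: p_F_letter)
  also have "\<dots> = p (pull [a] X - pull [a] A) \<oplus> p (pull [a] A)"
    using p_split[of "pull [a] X" "pull [a] A"] compl by (simp add: A a_comm)
  finally have "t a \<otimes> p (X - A) \<otimes> s a = p (pull [a] X - pull [a] A)"
    using compl by (simp add: add.right_cancel)
  moreover have "pull [a] (X - A) = pull [a] X - pull [a] A" by (auto simp: pull_def)
  ultimately show ?case by simp
qed

section \<open>Moving projections across words\<close>

lemma p_s: "A \<in> \<U> X \<Longrightarrow> p A \<otimes> s a = s a \<otimes> p (pull [a] A)"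
  by (metis p_s_conv t_p_s)

lemma t_p: "A \<in> \<U> X \<Longrightarrow> t a \<otimes> p A = p (pull [a] A) \<otimes> t a"
proof -
  assume A: "A \<in> \<U> X"
  have "t a \<otimes> p A = t a \<otimes> ((s a \<otimes> t a) \<otimes> p A)"
    using A t_s_t[of a] by (simp add: m_assoc[symmetric])
  also have "\<dots> = t a \<otimes> p A \<otimes> s a \<otimes> t a"
    using A by (simp only: p_t_s_commute[OF A, symmetric]) (simp add: m_assoc)
  finally show ?thesis using A by (simp add: t_p_s)
qed

lemma p_S: "A \<in> \<U> X \<Longrightarrow> p A \<otimes> S \<alpha> = S \<alpha> \<otimes> p (pull \<alpha> A)"
proof (induction \<alpha> arbitrary: A)
  case (Cons a \<alpha>)
  have "p A \<otimes> S (a # \<alpha>) = p A \<otimes> s a \<otimes> S \<alpha>"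
    using Cons by (simp add: m_assoc)
  also have "\<dots> = s a \<otimes> (p (pull [a] A) \<otimes> S \<alpha>)"
    using Cons by (simp add: m_assoc p_s)
  also have "\<dots> = S (a # \<alpha>) \<otimes> p (pull ([a] @ \<alpha>) A)"
    using Cons by (simp add: m_assoc pull_append del: append_Cons)
  finally show ?case by simp
qed simp

lemma T_p: "A \<in> \<U> X \<Longrightarrow> T \<alpha> \<otimes> p A = p (pull \<alpha> A) \<otimes> T \<alpha>"
proof (induction \<alpha> arbitrary: A)
  case (Cons a \<alpha>)
  have "T (a # \<alpha>) \<otimes> p A = T \<alpha> \<otimes> (t a \<otimes> p A)"
    using Cons.prems unfolding T_Cons by (simp add: m_assoc)
  also have "\<dots> = T \<alpha> \<otimes> p (pull [a] A) \<otimes> t a"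
    using Cons.prems by (simp add: m_assoc t_p)
  also have "\<dots> = p (pull ([a] @ \<alpha>) A) \<otimes> T (a # \<alpha>)"
    using Cons unfolding T_Cons pull_append by (simp add: m_assoc)
  finally show ?case by simp
qed simp

lemma T_absorb: "p (pull \<alpha> X) \<otimes> T \<alpha> = T \<alpha>"
  using T_p[of X \<alpha>] by simp

text \<open>\<open>T \<alpha>\<close> absorbs the projection of \<open>pull \<alpha> X\<close> on
  its left, and \<open>pull\<close> after \<open>push\<close> is intersection with that set; so
  \<open>T_p\<close> can be read backwards.\<close>

lemma p_T: "A \<in> \<U> X \<Longrightarrow> p A \<otimes> T \<alpha> = T \<alpha> \<otimes> p (push X \<alpha> A)"
proof -
  assume A: "A \<in> \<U> X"
  have "p A \<otimes> T \<alpha> = p A \<otimes> (p (pull \<alpha> X) \<otimes> T \<alpha>)"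
    by (simp only: T_absorb)
  also have "\<dots> = T \<alpha> \<otimes> p (push X \<alpha> A)"
    using A by (simp add: T_p pull_push)
  finally show ?thesis .
qed

text \<open>One letter at a time: with \<open>?E\<close> the set pushed along the whole word, the
  inner projection becomes \<open>t a \<otimes> p ?E \<otimes> s a\<close>. The outer
  \<open>s a\<close> and \<open>t a\<close> complete it to cylinder projections, which are absorbed
  because \<open>?E\<close> lies in that cylinder.\<close>

lemma S_p_T: "A \<in> \<U> X \<Longrightarrow> S \<alpha> \<otimes> p A \<otimes> T \<alpha> = p (push X \<alpha> A)"
proof (induction \<alpha> arbitrary: A)
  case Nil
  moreover have "push X [] A = A" using U_subset[OF Nil] by (auto simp: push_def)
  ultimately show ?case by simp
next
  case (Cons a \<alpha>)
  let ?D = "push X \<alpha> A" and ?E = "push X (a # \<alpha>) A"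
  have U: "?D \<in> \<U> X" "?E \<in> \<U> X" using Cons by simp_all
  have 1: "pull [a] ?E = pull [a] X \<inter> ?D" 
    using build_closed by (auto simp: push_def pull_def)
  have 2: "?E = \<C> X [] [a] \<inter> ?E \<inter> \<C> X [] [a]"
    using build_closed by (auto simp: push_def \<C>_def)
  have "S (a # \<alpha>) \<otimes> p A \<otimes> T (a # \<alpha>) = s a \<otimes> (S \<alpha> \<otimes> p A \<otimes> T \<alpha>) \<otimes> t a"
    using Cons.prems unfolding T_Cons by (simp add: m_assoc)
  also have "\<dots> = (s a \<otimes> t a \<otimes> s a) \<otimes> p ?D \<otimes> t a"
    using Cons by (simp add: s_t_s)
  also have "\<dots> = s a \<otimes> (p (pull [a] X) \<otimes> p ?D) \<otimes> t a"
    using U by (simp add: p_F_letter m_assoc del: p_mult p_mult_left)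
  also have "\<dots> = s a \<otimes> (t a \<otimes> p ?E \<otimes> s a) \<otimes> t a"
    using U by (simp add: t_p_s 1)
  also have "\<dots> = p (\<C> X [] [a]) \<otimes> p ?E \<otimes> p (\<C> X [] [a])"
    using U by (simp add: p_Z m_assoc del: p_mult p_mult_left)
  also have "\<dots> = p ?E"
    using U 2 by simp
  finally show ?case .
qed

end

section \<open>Reduction to combinations of adjoint words\<close>

context subshift_ring
begin

text \<open>The span of the monomials with left word of length at most \<open>n\<close>. Only the
  left word is bounded: multiplication by \<open>t a\<close> lowers this bound, so it can serve as
  induction parameter.\<close>

inductive_set Comb :: "nat \<Rightarrow> 'b set" for n where
  Comb_zero [simp]: "\<zero> \<in> Comb n"
| Comb_insert: "length \<alpha> \<le> n \<Longrightarrow> A \<in> \<U> X \<Longrightarrow> x \<in> Comb n \<Longrightarrow>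
    k r \<otimes> (S \<alpha> \<otimes> (p A \<otimes> T \<beta>)) \<oplus> x \<in> Comb n"

lemma Comb_closed: "x \<in> Comb n \<Longrightarrow> x \<in> carrier B"
  by (induction rule: Comb.induct) auto

lemma Comb_mono: "x \<in> Comb m \<Longrightarrow> m \<le> n \<Longrightarrow> x \<in> Comb n"
  by (induction rule: Comb.induct) (auto intro: Comb_insert)

lemma Comb_add: "x \<in> Comb n \<Longrightarrow> y \<in> Comb n \<Longrightarrow> x \<oplus> y \<in> Comb n"
proof (induction rule: Comb.induct)
  case Comb_zero
  then show ?case using Comb_closed by simp
next
  case (Comb_insert \<alpha> A x r \<beta>)
  then show ?case
    using Comb.Comb_insert[of \<alpha> n A "x \<oplus> y" r \<beta>] Comb_closed by (simp add: a_assoc)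
qed

lemma Comb_term: "length \<alpha> \<le> n \<Longrightarrow> A \<in> \<U> X \<Longrightarrow> S \<alpha> \<otimes> (p A \<otimes> T \<beta>) \<in> Comb n"
  using Comb_insert[of \<alpha> n A \<zero> 1 \<beta>] by simp

lemma Comb_k: "x \<in> Comb n \<Longrightarrow> k r \<otimes> x \<in> Comb n"
proof (induction rule: Comb.induct)
  case (Comb_insert \<alpha> A x r' \<beta>)
  then show ?case
    using Comb.Comb_insert[of \<alpha> n A "k r \<otimes> x" "r * r'" \<beta>] Comb_closed[of x]
    by (simp add: r_distr k_mult m_assoc del: p_mult_left)
qed simp

lemma k_left_comm: "x \<in> carrier B \<Longrightarrow> y \<in> carrier B \<Longrightarrow> x \<otimes> (k r \<otimes> y) = k r \<otimes> (x \<otimes> y)"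
  by (metis k_comm k_closed m_assoc)

lemma Comb_mult:
  assumes "x \<in> Comb n" "b \<in> carrier B"
    and "\<And>\<alpha> A \<beta>. length \<alpha> \<le> n \<Longrightarrow> A \<in> \<U> X \<Longrightarrow> b \<otimes> (S \<alpha> \<otimes> (p A \<otimes> T \<beta>)) \<in> Comb m"
  shows "b \<otimes> x \<in> Comb m"
  using assms(1)
proof (induction rule: Comb.induct)
  case (Comb_insert \<alpha> A x r \<beta>)
  then have "b \<otimes> (k r \<otimes> (S \<alpha> \<otimes> (p A \<otimes> T \<beta>)) \<oplus> x) =
      k r \<otimes> (b \<otimes> (S \<alpha> \<otimes> (p A \<otimes> T \<beta>))) \<oplus> b \<otimes> x"
    using assms(2) Comb_closed[of x] by (simp add: r_distr k_left_comm)
  then show ?case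
    using Comb_insert assms(3) by (simp add: Comb_add Comb_k)
qed (use assms in simp)

lemma p_S_p_T: "A \<in> \<U> X \<Longrightarrow> D \<in> \<U> X \<Longrightarrow>
    p D \<otimes> (S \<alpha> \<otimes> (p A \<otimes> T \<beta>)) = S \<alpha> \<otimes> (p (pull \<alpha> D \<inter> A) \<otimes> T \<beta>)"
  by (simp add: m_assoc[symmetric] p_S) (simp add: m_assoc)

lemma Comb_p: "x \<in> Comb n \<Longrightarrow> D \<in> \<U> X \<Longrightarrow> p D \<otimes> x \<in> Comb n"
  by (erule Comb_mult) (simp_all add: p_S_p_T Comb_term)

lemma Comb_s: "x \<in> Comb n \<Longrightarrow> s a \<otimes> x \<in> Comb (Suc n)"
proof (erule Comb_mult)
  fix \<alpha> \<beta> :: "'a list" and A assume "length \<alpha> \<le> n" "A \<in> \<U> X"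
  then show "s a \<otimes> (S \<alpha> \<otimes> (p A \<otimes> T \<beta>)) \<in> Comb (Suc n)"
    using Comb_term[of "a # \<alpha>" "Suc n" A \<beta>] by (simp add: m_assoc)
qed simp

text \<open>\<open>t a\<close> kills a term with nonempty left word or cancels its first letter up
  to a projection; with empty left word it moves past \<open>p A\<close> and lengthens
  \<open>\<beta>\<close>. For \<open>n = 0\<close> only the latter occurs, so truncated subtraction
  does no harm.\<close>

lemma Comb_t: "x \<in> Comb n \<Longrightarrow> t a \<otimes> x \<in> Comb (n - 1)"
proof (erule Comb_mult)
  fix \<alpha> \<beta> :: "'a list" and A assume A: "length \<alpha> \<le> n" "A \<in> \<U> X"
  show "t a \<otimes> (S \<alpha> \<otimes> (p A \<otimes> T \<beta>)) \<in> Comb (n - 1)"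
  proof (cases \<alpha>)
    case Nil
    have "t a \<otimes> (p A \<otimes> T \<beta>) = p (pull [a] A) \<otimes> T (\<beta> @ [a])"
      using A by (simp add: m_assoc[symmetric] t_p T_snoc del: rev_append)
    then show ?thesis
      using Comb_term[of "[]" "n - 1" "pull [a] A" "\<beta> @ [a]"] A Nil by (simp del: rev_append)
  next
    case (Cons b \<alpha>')
    have eq: "t a \<otimes> (S \<alpha> \<otimes> (p A \<otimes> T \<beta>)) = (t a \<otimes> s b) \<otimes> (S \<alpha>' \<otimes> (p A \<otimes> T \<beta>))"
      using A Cons by (simp add: m_assoc)
    show ?thesis
    proof (cases "a = b")
      case True
      then show ?thesis
        unfolding eq using A Cons Comb_term[of \<alpha>' "n - 1"]
        by (simp add: p_F_letter[symmetric] p_S_p_T)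
    qed (use eq A t_s_distinct in simp)
  qed
qed simp

lemma carrier_Comb: "x \<in> carrier B \<Longrightarrow> \<exists>n. x \<in> Comb n"
proof -
  have "(\<Union>n. Comb n) = carrier B"
  proof (rule generated)
    show "(\<Union>n. Comb n) \<subseteq> carrier B" using Comb_closed by auto
    show "\<one> \<in> (\<Union>n. Comb n)"
      using Comb_term[of "[]" 0 X "[]"] by auto
  next
    fix x y assume "x \<in> (\<Union>n. Comb n)" "y \<in> (\<Union>n. Comb n)"
    then obtain m n where "x \<in> Comb m" "y \<in> Comb n" by auto
    then have "x \<oplus> y \<in> Comb (max m n)"
      by (intro Comb_add) (auto elim: Comb_mono)
    then show "x \<oplus> y \<in> (\<Union>n. Comb n)" by blast
  qed (auto intro: Comb_k Comb_p Comb_s Comb_t)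
  then show "x \<in> carrier B \<Longrightarrow> \<exists>n. x \<in> Comb n" by blast
qed

text \<open>
  Over an infinite alphabet \<open>1\<close> is not a finite sum of cylinder projections, so a nonzero \<open>z\<close> may
  satisfy \<open>t a \<otimes> z = \<zero>\<close> for all letters \<open>a\<close>. For such \<open>z\<close>, removing the finitely many cylinders that
  occur in a combination leaves \<open>z\<close> unchanged and kills all terms with nonempty \<open>\<alpha>\<close>.
\<close>

lemma Comb_cut_letters:
  "x \<in> Comb n \<Longrightarrow> \<exists>D\<in>\<U> X. p D \<otimes> x \<in> Comb 0 \<and>
    (\<forall>z\<in>carrier B. (\<forall>a. t a \<otimes> z = \<zero>) \<longrightarrow> p D \<otimes> z = z)"
proof (induction rule: Comb.induct)
  case Comb_zero
  then show ?case by (intro bexI[of _ X]) auto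
next
  case (Comb_insert \<alpha> A x r \<beta>)
  then obtain D where D: "D \<in> \<U> X" "p D \<otimes> x \<in> Comb 0"
      "\<And>z. z \<in> carrier B \<Longrightarrow> \<forall>a. t a \<otimes> z = \<zero> \<Longrightarrow> p D \<otimes> z = z"
    by blast
  have x: "x \<in> carrier B" using Comb_insert Comb_closed by blast
  show ?case
  proof (cases \<alpha>)
    case Nil
    have "p D \<otimes> (k r \<otimes> (S \<alpha> \<otimes> (p A \<otimes> T \<beta>)) \<oplus> x) = k r \<otimes> (S [] \<otimes> (p (D \<inter> A) \<otimes> T \<beta>)) \<oplus> p D \<otimes> x"
      using D Comb_insert.hyps x Nil by (simp add: r_distr k_left_comm)
    then show ?thesis
      using D Comb_insert.hyps Comb.Comb_insert[of "[]" 0 "D \<inter> A"] by (intro bexI[of _ D]) auto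
  next
    case (Cons a \<alpha>')
    define D' where "D' = D - \<C> X [] [a]"
    have D': "D' \<in> \<U> X" "D' = (X - \<C> X [] [a]) \<inter> D"
      using D U_subset[OF D(1)] by (auto simp: D'_def)
    have "pull \<alpha> D' \<inter> A = {}"
      using U_subset[OF D(1)] build_closed by (fastforce simp: pull_def D'_def \<C>_def Cons)
    then have "p D' \<otimes> (S \<alpha> \<otimes> (p A \<otimes> T \<beta>)) = \<zero>"
      using D' Comb_insert.hyps by (simp add: p_S_p_T)
    then have "p D' \<otimes> (k r \<otimes> (S \<alpha> \<otimes> (p A \<otimes> T \<beta>)) \<oplus> x) = p D' \<otimes> x"
      using D' Comb_insert.hyps x by (simp add: r_distr k_left_comm del: p_mult_left)
    also have "\<dots> = p (X - \<C> X [] [a]) \<otimes> (p D \<otimes> x)"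
      using D D'(2) x by simp
    finally have 1: "p D' \<otimes> (k r \<otimes> (S \<alpha> \<otimes> (p A \<otimes> T \<beta>)) \<oplus> x) \<in> Comb 0"
      using D Comb_p by simp
    have "p D' \<otimes> z = z" if z: "z \<in> carrier B" "\<forall>a. t a \<otimes> z = \<zero>" for z
    proof -
      \<comment> \<open>The part of \<open>z\<close> on the removed cylinder factors through
        \<open>t a \<otimes> z\<close>.\<close>
      have "p (D \<inter> \<C> X [] [a]) \<otimes> z = p D \<otimes> (s a \<otimes> (t a \<otimes> z))"
        using D z by (simp only: p_Int U_C p_Z) (simp add: m_assoc)
      also have "\<dots> = \<zero>"
        using z D by simp
      finally have "p D \<otimes> z = p D' \<otimes> z"
        using p_split[of D "\<C> X [] [a]"] D D'(1) z by (simp add: l_distr D'_def)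
      then show ?thesis using D z by simp
    qed
    then show ?thesis using 1 D' by blast
  qed
qed

text \<open>If some \<open>t a \<otimes> x\<close> is nonzero, it has a smaller bound and induction
  applies. Otherwise \<open>x\<close> is fixed by the projection from
  \<open>Comb_cut_letters\<close> and hence lies in \<open>Comb 0\<close> itself.\<close>

lemma reduce_to_Comb_0:
  "x \<in> Comb n \<Longrightarrow> x \<noteq> \<zero> \<Longrightarrow> \<exists>y\<in>carrier B. y \<otimes> x \<noteq> \<zero> \<and> y \<otimes> x \<in> Comb 0"
proof (induction n arbitrary: x)
  case 0
  then show ?case using Comb_closed by (intro bexI[of _ \<one>]) auto
next
  case (Suc n)
  have x: "x \<in> carrier B" using Suc Comb_closed by blast
  show ?case
  proof (cases "\<forall>a. t a \<otimes> x = \<zero>")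
    case True
    then have "x \<in> Comb 0"
      using Comb_cut_letters[OF Suc.prems(1)] x by metis
    then show ?thesis using Suc.prems x by (intro bexI[of _ \<one>]) auto
  next
    case False
    then obtain a where a: "t a \<otimes> x \<noteq> \<zero>" by blast
    then obtain y where "y \<in> carrier B" "y \<otimes> (t a \<otimes> x) \<noteq> \<zero>" "y \<otimes> (t a \<otimes> x) \<in> Comb 0"
      using Suc.IH[of "t a \<otimes> x"] Comb_t[OF Suc.prems(1)] by auto
    then show ?thesis using x by (intro bexI[of _ "y \<otimes> t a"]) (auto simp: m_assoc)
  qed
qed

section \<open>Linear combinations of adjoint words\<close>

definition T_sum :: "'a list set \<Rightarrow> ('a list \<Rightarrow> 'r) \<Rightarrow> 'b" where
  "T_sum W c = (\<Oplus>\<beta>\<in>W. k (c \<beta>) \<otimes> T \<beta>)"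

lemma T_sum_closed [simp]: "T_sum W c \<in> carrier B"
  unfolding T_sum_def by (rule finsum_closed) auto

lemma k_0 [simp]: "k 0 = \<zero>"
  using k_add[of 0 0] add.l_cancel_one[of "k 0" "k 0"] by simp

lemma T_sum_neutral: "finite W \<Longrightarrow> T_sum {\<beta> \<in> W. c \<beta> \<noteq> 0} c = T_sum W c"
  unfolding T_sum_def by (rule add.finprod_mono_neutral_cong_left) auto

lemma T_sum_insert:
  "finite W \<Longrightarrow> \<beta> \<notin> W \<Longrightarrow> T_sum (insert \<beta> W) c = k (c \<beta>) \<otimes> T \<beta> \<oplus> T_sum W c"
  unfolding T_sum_def by (rule finsum_insert) auto

lemma T_sum_cong: "(\<And>\<beta>. \<beta> \<in> W \<Longrightarrow> c \<beta> = c' \<beta>) \<Longrightarrow> T_sum W c = T_sum W c'"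
  unfolding T_sum_def by (rule add.finprod_cong') auto

text \<open>As \<open>c\<close> vanishes off \<open>W\<close>, one formula covers a new word and a
  word whose coefficient is changed.\<close>

lemma T_sum_add_term:
  assumes "finite W" "\<And>\<beta>. \<beta> \<notin> W \<Longrightarrow> c \<beta> = 0"
  shows "k r \<otimes> T \<beta> \<oplus> T_sum W c = T_sum (insert \<beta> W) (c(\<beta> := r + c \<beta>))"
proof -
  have "T_sum W c = k (c \<beta>) \<otimes> T \<beta> \<oplus> T_sum (W - {\<beta>}) c"
  proof (cases "\<beta> \<in> W")
    case True
    then show ?thesis using T_sum_insert[of "W - {\<beta>}" \<beta> c] assms by (simp add: insert_absorb)
  qed (use assms in simp)
  moreover have "T_sum (insert \<beta> W) (c(\<beta> := r + c \<beta>)) =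
      k (r + c \<beta>) \<otimes> T \<beta> \<oplus> T_sum (W - {\<beta>}) (c(\<beta> := r + c \<beta>))"
    using T_sum_insert[of "W - {\<beta>}" \<beta> "c(\<beta> := r + c \<beta>)"] assms by simp
  moreover have "T_sum (W - {\<beta>}) (c(\<beta> := r + c \<beta>)) = T_sum (W - {\<beta>}) c"
    by (rule T_sum_cong) auto
  ultimately show ?thesis
    by (simp add: k_add l_distr a_assoc)
qed

text \<open>Each new term cuts \<open>D\<close> into the part where the term is defined and the part
  where it vanishes, and \<open>y\<close> survives on one of them. Keeping \<open>y\<close> fixed
  while \<open>x\<close> grows carries the nonvanishing through the induction; the application has
  \<open>y = x\<close>.\<close>

lemma Comb_0_localize:
  assumes "x \<in> Comb 0" "y \<in> carrier B" "A \<in> \<U> X" "p A \<otimes> y \<noteq> \<zero>"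
  shows "\<exists>D W c. D \<in> \<U> X \<and> p D \<otimes> y \<noteq> \<zero> \<and> finite W \<and> (\<forall>\<beta>. \<beta> \<notin> W \<longrightarrow> c \<beta> = 0) \<and>
    (\<forall>\<beta>\<in>W. D \<subseteq> pull \<beta> X) \<and> p D \<otimes> x = p D \<otimes> T_sum W c"
  using assms(1)
proof (induction rule: Comb.induct)
  case Comb_zero
  then show ?case
    using assms by (intro exI[of _ A] exI[of _ "{}"] exI[of _ "\<lambda>_. 0"]) (auto simp: T_sum_def)
next
  case (Comb_insert \<alpha> C x r \<beta>)
  then obtain D W c where D: "D \<in> \<U> X" "p D \<otimes> y \<noteq> \<zero>" "finite W" "\<And>\<beta>. \<beta> \<notin> W \<Longrightarrow> c \<beta> = 0"
      "\<And>\<beta>. \<beta> \<in> W \<Longrightarrow> D \<subseteq> pull \<beta> X" "p D \<otimes> x = p D \<otimes> T_sum W c"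
    by blast
  have x: "x \<in> carrier B" using Comb_insert Comb_closed by blast
  have C: "C \<in> \<U> X" using Comb_insert by simp
  have restrict: "p D' \<otimes> x = p D' \<otimes> T_sum W c" if "D' \<in> \<U> X" "D' \<subseteq> D" for D'
  proof -
    have *: "p D' \<otimes> z = p D' \<otimes> (p D \<otimes> z)" if "z \<in> carrier B" for z
      using D(1) \<open>D' \<in> \<U> X\<close> \<open>D' \<subseteq> D\<close> that by (simp add: Int_absorb2)
    show ?thesis
      using *[OF x] *[of "T_sum W c"] D(6) by simp
  qed
  \<comment> \<open>The left word is empty, and the projection absorbed by \<open>T \<beta>\<close>
    shrinks \<open>C\<close> to the set where prefixing \<open>\<beta>\<close> stays in
    \<open>X\<close>.\<close>
  define E where "E = C \<inter> pull \<beta> X"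
  have E: "E \<in> \<U> X" using C by (simp add: E_def)
  have eq: "k r \<otimes> (S \<alpha> \<otimes> (p C \<otimes> T \<beta>)) = k r \<otimes> (p E \<otimes> T \<beta>)"
    using Comb_insert.hyps T_absorb[of \<beta>] C unfolding E_def
    by (simp add: p_Int m_assoc del: p_mult p_mult_left)
  have "p (D \<inter> E) \<otimes> y \<oplus> p (D - E) \<otimes> y \<noteq> \<zero>"
    using D E assms p_split[of D E] by (simp add: l_distr[symmetric])
  then consider "p (D \<inter> E) \<otimes> y \<noteq> \<zero>" | "p (D - E) \<otimes> y \<noteq> \<zero>"
    by (metis r_zero zero_closed)
  then show ?case
  proof cases
    case 1
    have "p (D \<inter> E) \<otimes> (k r \<otimes> (S \<alpha> \<otimes> (p C \<otimes> T \<beta>)) \<oplus> x) =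
        p (D \<inter> E) \<otimes> (k r \<otimes> T \<beta>) \<oplus> p (D \<inter> E) \<otimes> T_sum W c"
      unfolding eq using restrict[of "D \<inter> E"] D E x
      by (simp add: r_distr k_left_comm Int_assoc)
    also have "\<dots> = p (D \<inter> E) \<otimes> T_sum (insert \<beta> W) (c(\<beta> := r + c \<beta>))"
      using T_sum_add_term[OF D(3,4), where r = r and \<beta> = \<beta>] D E by (simp add: r_distr[symmetric])
    finally have "p (D \<inter> E) \<otimes> (k r \<otimes> (S \<alpha> \<otimes> (p C \<otimes> T \<beta>)) \<oplus> x) =
        p (D \<inter> E) \<otimes> T_sum (insert \<beta> W) (c(\<beta> := r + c \<beta>))" .
    moreover have "\<forall>\<beta>'. \<beta>' \<notin> insert \<beta> W \<longrightarrow> (c(\<beta> := r + c \<beta>)) \<beta>' = 0"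
      "\<forall>\<beta>'\<in>insert \<beta> W. D \<inter> E \<subseteq> pull \<beta>' X" "D \<inter> E \<in> \<U> X" "finite (insert \<beta> W)"
      using D E by (auto simp: E_def)
    ultimately show ?thesis
      using 1 by blast
  next
    case 2
    have "(D - E) \<inter> E = {}" by auto
    then have "p (D - E) \<otimes> (k r \<otimes> (S \<alpha> \<otimes> (p C \<otimes> T \<beta>)) \<oplus> x) = p (D - E) \<otimes> T_sum W c"
      unfolding eq using restrict[of "D - E"] D E x by (simp add: r_distr k_left_comm)
    then show ?thesis
      using 2 D E by (intro exI[of _ "D - E"] exI[of _ W] exI[of _ c]) auto
  qed
qed

text \<open>The localization is applied to an element of \<open>Comb 0\<close> as its own witness,
  and words with zero coefficient are dropped afterwards.\<close>

lemma reduction: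
  assumes "x \<in> carrier B" "x \<noteq> \<zero>"
  obtains y A W c where "y \<in> carrier B" "A \<in> \<U> X" "finite W" "\<And>\<beta>. \<beta> \<in> W \<Longrightarrow> c \<beta> \<noteq> 0"
    "\<And>\<beta>. \<beta> \<in> W \<Longrightarrow> A \<subseteq> pull \<beta> X" "y \<otimes> x = p A \<otimes> T_sum W c" "y \<otimes> x \<noteq> \<zero>"
proof -
  obtain y where y: "y \<in> carrier B" "y \<otimes> x \<noteq> \<zero>" "y \<otimes> x \<in> Comb 0"
    using carrier_Comb reduce_to_Comb_0 assms by metis
  then obtain D W c where D: "D \<in> \<U> X" "p D \<otimes> (y \<otimes> x) \<noteq> \<zero>" "finite W"
      "\<forall>\<beta>\<in>W. D \<subseteq> pull \<beta> X" "p D \<otimes> (y \<otimes> x) = p D \<otimes> T_sum W c"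
    using Comb_0_localize[of "y \<otimes> x" "y \<otimes> x" X] assms by auto
  show thesis
    by (rule that[of "p D \<otimes> y" D "{\<beta> \<in> W. c \<beta> \<noteq> 0}" c])
      (use D y assms in \<open>auto simp: T_sum_neutral m_assoc\<close>)
qed

end

section \<open>Powers of \<open>1 + h\<close> and eventually periodic points\<close>

text \<open>Substituting a polynomial of degree one is injective; in other words,
  \<open>1 + fps_X\<close> is transcendental over the field.\<close>

lemma fps_of_poly_shift_eq_0:
  fixes P :: "'r::field poly"
  shows "fps_of_poly (P \<circ>\<^sub>p [:1, 1:]) = 0 \<Longrightarrow> P = 0"
  using pcompose_eq_0[of P "[:1, 1:]"] fps_of_poly_eq_iff[of "P \<circ>\<^sub>p [:1, 1:]" 0] by simp

lemma fps_of_poly_shift_monom: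
  "fps_of_poly (monom c n \<circ>\<^sub>p [:1, 1::'r::field:]) = fps_const c * (1 + fps_X) ^ n"
proof (induction n)
  case (Suc n)
  have "monom c (Suc n) \<circ>\<^sub>p [:1, 1:] = [:1, 1:] * (monom c n \<circ>\<^sub>p [:1, 1:])"
    by (simp add: monom_Suc pcompose_pCons del: mult_pCons_left)
  then show ?case
    using Suc by (simp only: fps_of_poly_mult fps_of_poly_linear') (simp add: mult_ac)
qed (simp add: monom_0 fps_of_poly_const)

text \<open>The sum is a polynomial evaluated at \<open>1 + fps_X\<close>. Injectivity of the
  exponents keeps its monomials apart, so the coefficient \<open>c i\<close> survives.\<close>

lemma sum_powers_one_plus_X_nonzero:
  fixes c :: "'i \<Rightarrow> 'r::field"
  assumes "finite W" "inj_on n W" "i \<in> W" "c i \<noteq> 0"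
  shows "(\<Sum>i\<in>W. fps_const (c i) * (1 + fps_X) ^ n i) \<noteq> 0"
proof
  define P where "P = (\<Sum>i\<in>W. monom (c i) (n i))"
  assume "(\<Sum>i\<in>W. fps_const (c i) * (1 + fps_X) ^ n i) = 0"
  then have "fps_of_poly (P \<circ>\<^sub>p [:1, 1:]) = 0"
    by (simp add: P_def pcompose_sum fps_of_poly_sum fps_of_poly_shift_monom)
  then have "P = 0" by (rule fps_of_poly_shift_eq_0)
  moreover have "coeff P (n i) = (\<Sum>j\<in>W. if j = i then c i else 0)"
    unfolding P_def coeff_sum using assms by (intro sum.cong) (auto simp: inj_on_def)
  ultimately show False using assms by simp
qed

lemma one_plus_X_power_neq_1: "m > 0 \<Longrightarrow> (1 + fps_X :: 'r::field fps) ^ m \<noteq> 1"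
proof
  assume m: "m > 0" "(1 + fps_X :: 'r fps) ^ m = 1"
  then have "fps_of_poly ((monom 1 m - monom (1::'r) 0) \<circ>\<^sub>p [:1, 1:]) = 0"
    by (simp add: pcompose_diff fps_of_poly_diff fps_of_poly_shift_monom del: monom_eq_1)
  then have "monom 1 m - monom (1::'r) 0 = 0" by (rule fps_of_poly_shift_eq_0)
  then have "coeff (monom 1 m - monom (1::'r) 0) m = 0" by simp
  then show False using m by simp
qed

text \<open>Extension by zero: a word that prefixes a point out of \<open>X\<close> contributes zero
  without a side condition.\<close>

definition fun_space :: "'a word set \<Rightarrow> ('a word \<Rightarrow> 'r::zero fps) set" where
  "fun_space X = {\<phi>. \<forall>x. x \<notin> X \<longrightarrow> \<phi> x = 0}"

definition eventually_periodic :: "'a word \<Rightarrow> bool" where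
  "eventually_periodic x \<longleftrightarrow> (\<exists>\<alpha> \<gamma>. \<gamma> \<noteq> [] \<and> x = \<alpha> \<frown> \<gamma>\<^sup>\<omega>)"

text \<open>Copies of \<open>\<gamma>\<close> are absorbed into the preperiod until it is at least
  as long as \<open>\<beta>\<close>; cutting off \<open>\<beta>\<close> then leaves the periodic
  tail intact.\<close>

lemma eventually_periodic_suffix:
  assumes "eventually_periodic (\<beta> \<frown> x)"
  shows "eventually_periodic x"
proof -
  obtain \<alpha> \<gamma> where \<gamma>: "\<gamma> \<noteq> []" "\<beta> \<frown> x = \<alpha> \<frown> \<gamma>\<^sup>\<omega>"
    using assms by (auto simp: eventually_periodic_def)
  have "\<exists>\<alpha>'. length \<alpha>' \<ge> n \<and> \<alpha> \<frown> \<gamma>\<^sup>\<omega> = \<alpha>' \<frown> \<gamma>\<^sup>\<omega>" for n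
  proof (induction n)
    case (Suc n)
    then obtain \<alpha>' where \<alpha>': "length \<alpha>' \<ge> n" "\<alpha> \<frown> \<gamma>\<^sup>\<omega> = \<alpha>' \<frown> \<gamma>\<^sup>\<omega>" by blast
    have "\<alpha>' \<frown> \<gamma>\<^sup>\<omega> = \<alpha>' \<frown> \<gamma> \<frown> \<gamma>\<^sup>\<omega>"
      using iter_unroll[of \<gamma>] \<gamma> by simp
    moreover have "length (\<alpha>' @ \<gamma>) \<ge> Suc n"
      using \<alpha>' \<gamma> by (cases \<gamma>) auto
    ultimately show ?case using \<alpha>' by (metis conc_conc)
  qed auto
  then obtain \<alpha>' where \<alpha>': "length \<alpha>' \<ge> length \<beta>" "\<beta> \<frown> x = \<alpha>' \<frown> \<gamma>\<^sup>\<omega>"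
    using \<gamma> by metis
  then have "x = suffix (length \<beta>) (\<alpha>' \<frown> \<gamma>\<^sup>\<omega>)"
    by (metis suffix_conc_length)
  then have "x = drop (length \<beta>) \<alpha>' \<frown> \<gamma>\<^sup>\<omega>"
    using \<alpha>' by simp
  then show ?thesis using \<gamma> by (auto simp: eventually_periodic_def)
qed

text \<open>For a point of \<open>X\<close> the language conditions are automatic, since preperiod
  and period occur in the point.\<close>

lemma (in shift_space) Q_singleton_iff: "{q} \<in> \<Q> X \<longleftrightarrow> {q} \<in> \<U> X \<and> \<not> eventually_periodic q"
proof -
  have "\<alpha> \<in> lang X \<and> \<gamma> \<in> lang X" if "q \<in> X" "\<gamma> \<noteq> []" "q = \<alpha> \<frown> \<gamma>\<^sup>\<omega>" for \<alpha> \<gamma>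
    using that lang_prefix[of \<alpha> "\<gamma>\<^sup>\<omega>" X] lang_infix[of \<alpha> \<gamma> "\<gamma>\<^sup>\<omega>" X] iter_unroll[of \<gamma>] by auto
  moreover have "q \<in> X" if "{q} \<in> \<U> X" using U_subset[OF that] by simp
  ultimately show ?thesis
    unfolding \<Q>_def eventually_periodic_def by blast
qed

lemma (in shift_space) Q_E:
  assumes "A \<in> \<Q> X"
  obtains q where "A = {q}" "{q} \<in> \<U> X" "\<not> eventually_periodic q"
proof -
  obtain q where "A = {q}" using assms by (auto simp: \<Q>_def)
  then show thesis using that assms Q_singleton_iff by blast
qed

section \<open>The socle of a represented subshift algebra\<close>

text \<open>The action is prescribed on \<open>k\<close>, \<open>p\<close> and \<open>t\<close>, the
  ingredients of reduced elements. Linearity over all power series, not merely over the field, is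
  what the periodic case exploits.\<close>

locale represented_subshift_ring = subshift_ring B X k p s t
  for B :: "'b ring" (structure) and X :: "'a word set" and k :: "'r::field \<Rightarrow> 'b"
    and p :: "'a word set \<Rightarrow> 'b" and s t :: "'a \<Rightarrow> 'b" +
  fixes act :: "'b \<Rightarrow> ('a word \<Rightarrow> 'r fps) \<Rightarrow> 'a word \<Rightarrow> 'r fps"
  assumes act_closed: "b \<in> carrier B \<Longrightarrow> \<phi> \<in> fun_space X \<Longrightarrow> act b \<phi> \<in> fun_space X"
    and act_mult: "b \<in> carrier B \<Longrightarrow> c \<in> carrier B \<Longrightarrow> \<phi> \<in> fun_space X \<Longrightarrow>
      act (b \<otimes> c) \<phi> = act b (act c \<phi>)"
    and act_add: "b \<in> carrier B \<Longrightarrow> c \<in> carrier B \<Longrightarrow> \<phi> \<in> fun_space X \<Longrightarrow>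
      act (b \<oplus> c) \<phi> x = act b \<phi> x + act c \<phi> x"
    and act_scale: "b \<in> carrier B \<Longrightarrow> \<phi> \<in> fun_space X \<Longrightarrow>
      act b (\<lambda>x. f * \<phi> x) x = f * act b \<phi> x"
    and act_k: "\<phi> \<in> fun_space X \<Longrightarrow> act (k r) \<phi> x = fps_const r * \<phi> x"
    and act_p: "A \<in> \<U> X \<Longrightarrow> \<phi> \<in> fun_space X \<Longrightarrow> act (p A) \<phi> x = (if x \<in> A then \<phi> x else 0)"
    and act_t: "\<phi> \<in> fun_space X \<Longrightarrow> act (t a) \<phi> x = (1 + fps_X) * \<phi> (a ## x)"
begin

definition \<delta> :: "'a word \<Rightarrow> 'a word \<Rightarrow> 'r fps" where
  "\<delta> q x = (if x = q then 1 else 0)"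

lemma \<delta>_fun_space: "q \<in> X \<Longrightarrow> \<delta> q \<in> fun_space X"
  by (auto simp: \<delta>_def fun_space_def)

section \<open>Evaluating reduced elements on indicator functions\<close>

lemma act_zero: "\<phi> \<in> fun_space X \<Longrightarrow> act \<zero> \<phi> x = 0"
  using act_k[of \<phi> 0 x] by simp

lemma act_T: "\<phi> \<in> fun_space X \<Longrightarrow> act (T \<beta>) \<phi> x = (1 + fps_X) ^ length \<beta> * \<phi> (\<beta> \<frown> x)"
proof (induction \<beta> arbitrary: \<phi>)
  case Nil
  then show ?case using act_k[of \<phi> 1 x] by simp
next
  case (Cons a \<beta>)
  have "act (T (a # \<beta>)) \<phi> x = act (T \<beta>) (act (t a) \<phi>) x"
    unfolding T_Cons by (simp only: act_mult T_closed t_closed Cons.prems)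
  also have "\<dots> = (1 + fps_X) ^ length \<beta> * act (t a) \<phi> (\<beta> \<frown> x)"
    by (rule Cons.IH) (simp add: act_closed Cons.prems)
  also have "\<dots> = (1 + fps_X) ^ length (a # \<beta>) * \<phi> ((a # \<beta>) \<frown> x)"
    using Cons.prems by (simp add: act_t mult_ac)
  finally show ?case .
qed

lemma act_T_sum:
  "finite W \<Longrightarrow> \<phi> \<in> fun_space X \<Longrightarrow>
    act (T_sum W c) \<phi> x = (\<Sum>\<beta>\<in>W. fps_const (c \<beta>) * (1 + fps_X) ^ length \<beta> * \<phi> (\<beta> \<frown> x))"
proof (induction W rule: finite_induct)
  case empty
  then show ?case by (simp add: T_sum_def act_zero)
next
  case (insert \<beta> W)
  then show ?case
    by (simp add: T_sum_insert act_add act_mult act_closed act_k act_T mult_ac)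
qed

text \<open>The indicator selects the words that send \<open>q\<close> to the same point. Two of
  them of equal length coincide, so the selected words carry distinct powers of
  \<open>1 + fps_X\<close> and cannot cancel.\<close>

lemma act_T_sum_\<delta>:
  assumes "finite W" "\<And>\<beta>. \<beta> \<in> W \<Longrightarrow> c \<beta> \<noteq> 0" "\<beta>\<^sub>0 \<in> W" "\<beta>\<^sub>0 \<frown> q \<in> X"
  shows "act (T_sum W c) (\<delta> (\<beta>\<^sub>0 \<frown> q)) q \<noteq> 0"
proof -
  let ?W = "{\<beta> \<in> W. \<beta> \<frown> q = \<beta>\<^sub>0 \<frown> q}"
  have "act (T_sum W c) (\<delta> (\<beta>\<^sub>0 \<frown> q)) q =
      (\<Sum>\<beta>\<in>W. if \<beta> \<frown> q = \<beta>\<^sub>0 \<frown> q then fps_const (c \<beta>) * (1 + fps_X) ^ length \<beta> else 0)"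
    using assms by (simp add: act_T_sum \<delta>_fun_space \<delta>_def if_distrib cong: if_cong)
  also have "\<dots> = (\<Sum>\<beta>\<in>?W. fps_const (c \<beta>) * (1 + fps_X) ^ length \<beta>)"
    using assms(1) by (rule sum.inter_filter[symmetric])
  also have "\<dots> \<noteq> 0"
  proof (rule sum_powers_one_plus_X_nonzero)
    show "inj_on length ?W"
      by (rule inj_onI) (metis (mono_tags, lifting) concat_eq mem_Collect_eq)
  qed (use assms in auto)
  finally show ?thesis .
qed

lemma act_p_T_sum:
  "A \<in> \<U> X \<Longrightarrow> \<phi> \<in> fun_space X \<Longrightarrow>
    act (p A \<otimes> T_sum W c) \<phi> x = (if x \<in> A then act (T_sum W c) \<phi> x else 0)"
  by (simp add: act_mult act_closed act_p)

lemma p_T_sum_nonzero: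
  assumes "finite W" "\<And>\<beta>. \<beta> \<in> W \<Longrightarrow> c \<beta> \<noteq> 0" "\<beta>\<^sub>0 \<in> W" "A \<in> \<U> X" "a \<in> A" "\<beta>\<^sub>0 \<frown> a \<in> X"
  shows "p A \<otimes> T_sum W c \<noteq> \<zero>"
proof
  assume "p A \<otimes> T_sum W c = \<zero>"
  then have "act (T_sum W c) (\<delta> (\<beta>\<^sub>0 \<frown> a)) a = 0"
    using act_p_T_sum[of A "\<delta> (\<beta>\<^sub>0 \<frown> a)" W c a] act_zero[of "\<delta> (\<beta>\<^sub>0 \<frown> a)" a] assms \<delta>_fun_space
    by simp
  then show False using act_T_sum_\<delta>[of W c \<beta>\<^sub>0 a] assms by blast
qed

lemma T_sum_empty [simp]: "T_sum {} c = \<zero>"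
  by (simp add: T_sum_def)

abbreviation p_ideal :: "'a word set \<Rightarrow> 'b set" where
  "p_ideal A \<equiv> {b \<otimes> p A | b. b \<in> carrier B}"

lemma minimal_left_ideal_p_ideal:
  assumes "A \<in> \<Q> X"
  shows "minimal_left_ideal (p_ideal A) B"
proof -
  obtain q where q: "A = {q}" "{q} \<in> \<U> X" "\<not> eventually_periodic q"
    using assms by (rule Q_E)
  have qX: "q \<in> X" using U_subset[OF q(2)] by simp
  have pA: "p A \<in> p_ideal A" using q by (auto intro!: exI[of _ \<one>])
  have "p A \<noteq> \<zero>"
  proof
    assume "p A = \<zero>"
    then have "act (p A) (\<delta> q) q = 0" using act_zero[OF \<delta>_fun_space[OF qX]] by simp
    then show False using act_p[of A "\<delta> q" q] q qX by (simp add: \<delta>_fun_space \<delta>_def)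
  qed
  then have "p_ideal A \<noteq> {\<zero>}" using pA by blast
  moreover have "J = p_ideal A" if J: "left_ideal J B" "J \<subseteq> p_ideal A" "J \<noteq> {\<zero>}" for J
  proof -
    have "\<zero> \<in> J" using J by (simp add: left_ideal_def additive_subgroup.zero_closed)
    then obtain x where x: "x \<in> J" "x \<noteq> \<zero>" using J by blast
    then obtain b where b: "x = b \<otimes> p A" "b \<in> carrier B" using J by blast
    then have "x \<in> carrier B" using q by simp
    then obtain y C W c where y: "y \<in> carrier B" "C \<in> \<U> X" "finite W" "\<And>\<beta>. \<beta> \<in> W \<Longrightarrow> c \<beta> \<noteq> 0"
      "\<And>\<beta>. \<beta> \<in> W \<Longrightarrow> C \<subseteq> pull \<beta> X" "y \<otimes> x = p C \<otimes> T_sum W c" "y \<otimes> x \<noteq> \<zero>"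
      using reduction x(2) by metis
    have x': "p C \<otimes> T_sum W c \<in> J"
      using y(1,6) x J by (metis left_ideal_def)
    have "C \<noteq> {}" "W \<noteq> {}" using y(2,6,7) by auto
    then obtain z \<beta>\<^sub>0 where z: "z \<in> C" "\<beta>\<^sub>0 \<in> W" by auto
    \<comment> \<open>A left multiple of \<open>p A\<close> kills the indicator of every point other
      than \<open>q\<close>, whereas the reduced form does not kill that of
      \<open>\<beta> \<frown> w\<close>.\<close>
    have fixed_end: "\<beta> \<frown> w = q" if "\<beta> \<in> W" "w \<in> C" for \<beta> w
    proof (rule ccontr)
      assume neq: "\<beta> \<frown> w \<noteq> q"
      have \<beta>X: "\<beta> \<frown> w \<in> X" using y(5) that by (auto simp: pull_def)
      then have "p A \<otimes> p A = p A" "act (p A) (\<delta> (\<beta> \<frown> w)) = (\<lambda>_. 0)"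
        using q neq by (auto simp: fun_eq_iff act_p \<delta>_fun_space \<delta>_def)
      moreover have "y \<otimes> x = y \<otimes> b \<otimes> p A" using b y q by (simp add: m_assoc)
      moreover have "(\<lambda>_. 0) \<in> fun_space X" by (simp add: fun_space_def)
      ultimately have "act (y \<otimes> x) (\<delta> (\<beta> \<frown> w)) = act (y \<otimes> b) (\<lambda>_. 0)"
        using act_mult[of "y \<otimes> b" "p A" "\<delta> (\<beta> \<frown> w)"] \<beta>X b y q by (simp add: \<delta>_fun_space)
      \<comment> \<open>Scaling by 0 shows that the zero function is sent to zero.\<close>
      moreover have "act (y \<otimes> b) (\<lambda>_. 0) w = 0"
        using act_scale[of "y \<otimes> b" "\<lambda>_. 0" 0 w] b y by (simp add: fun_space_def)
      ultimately have "act (y \<otimes> x) (\<delta> (\<beta> \<frown> w)) w = 0"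
        by simp
      then show False
        using act_T_sum_\<delta>[OF y(3,4) that(1) \<beta>X] that y(2) \<beta>X unfolding y(6)
        by (simp add: act_p_T_sum \<delta>_fun_space)
    qed
    \<comment> \<open>Prefixing \<open>\<beta>\<^sub>0\<close> is injective and sends all of
      \<open>C\<close> to \<open>q\<close>.\<close>
    have "C = {z}"
      using fixed_end[OF z(2)] z(1) by (metis insertI1 same_concat_eq singleton_iff subsetI subset_antisym)
    moreover have "W = {\<beta>\<^sub>0}"
    proof -
      have "\<beta> = \<beta>\<^sub>0" if "\<beta> \<in> W" for \<beta>
      proof (rule ccontr)
        assume "\<beta> \<noteq> \<beta>\<^sub>0"
        moreover have "\<beta> \<frown> z = \<beta>\<^sub>0 \<frown> z" using fixed_end that z by simp
        ultimately have "eventually_periodic (\<beta> \<frown> z)"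
          unfolding eventually_periodic_def by (intro conc_eq_conc_imp_periodic)
        then show False
          using fixed_end[OF that z(1)] q(3) by simp
      qed
      then show ?thesis using z by blast
    qed
    ultimately have eq: "p C \<otimes> T_sum W c = k (c \<beta>\<^sub>0) \<otimes> (p {z} \<otimes> T \<beta>\<^sub>0)"
      using y(2) T_sum_insert[of "{}" \<beta>\<^sub>0 c] by (simp add: k_left_comm)
    have zU: "{z} \<in> \<U> X" using y(2) \<open>C = {z}\<close> by simp
    \<comment> \<open>\<open>S \<beta>\<^sub>0\<close> carries the projection at \<open>z\<close> to
      the one at \<open>\<beta>\<^sub>0 \<frown> z = q\<close>, and the scalar is divided out, so
      \<open>p A\<close> itself lies in \<open>J\<close>.\<close>
    have "S \<beta>\<^sub>0 \<otimes> k (1 / c \<beta>\<^sub>0) \<otimes> (p C \<otimes> T_sum W c) = S \<beta>\<^sub>0 \<otimes> ((k (1 / c \<beta>\<^sub>0) \<otimes> k (c \<beta>\<^sub>0)) \<otimes> (p {z} \<otimes> T \<beta>\<^sub>0))"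
      unfolding eq using zU by (simp add: m_assoc del: p_mult_left)
    also have "\<dots> = S \<beta>\<^sub>0 \<otimes> p {z} \<otimes> T \<beta>\<^sub>0"
      using y(4)[OF z(2)] zU by (simp add: k_mult[symmetric] m_assoc)
    also have "\<dots> = p A"
      using zU fixed_end[OF z(2,1)] qX q by (simp add: S_p_T push_singleton)
    finally have "p A = S \<beta>\<^sub>0 \<otimes> k (1 / c \<beta>\<^sub>0) \<otimes> (p C \<otimes> T_sum W c)" ..
    then have "p A \<in> J"
      using x' J(1) unfolding left_ideal_def by simp
    then have "p_ideal A \<subseteq> J" using J(1) unfolding left_ideal_def by blast
    then show ?thesis using J by blast
  qed
  ultimately show ?thesis
    using left_ideal_principal[of "p A"] q unfolding minimal_left_ideal_def by auto
qed

text \<open>Reduction gives \<open>p A \<otimes> T_sum W c\<close> in \<open>I\<close>; once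
  \<open>A\<close> is known to be finite, multiplication by the projection of one of its points
  finishes.\<close>

lemma minimal_left_ideal_point:
  assumes "minimal_left_ideal I B"
  obtains q W c where "{q} \<in> \<U> X" "finite W" "W \<noteq> {}" "\<And>\<beta>. \<beta> \<in> W \<Longrightarrow> c \<beta> \<noteq> 0"
    "\<And>\<beta>. \<beta> \<in> W \<Longrightarrow> \<beta> \<frown> q \<in> X" "p {q} \<otimes> T_sum W c \<in> I"
proof -
  have I: "left_ideal I B" "I \<noteq> {\<zero>}" using assms by (auto simp: minimal_left_ideal_def)
  have "\<zero> \<in> I" using I by (simp add: left_ideal_def additive_subgroup.zero_closed)
  then obtain x where "x \<in> I" "x \<noteq> \<zero>" using I by blast
  moreover have "x \<in> carrier B" using left_ideal_subset[OF I(1)] \<open>x \<in> I\<close> by auto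
  ultimately obtain y A W c where y: "y \<in> carrier B" "A \<in> \<U> X" "finite W" "\<And>\<beta>. \<beta> \<in> W \<Longrightarrow> c \<beta> \<noteq> 0"
      "\<And>\<beta>. \<beta> \<in> W \<Longrightarrow> A \<subseteq> pull \<beta> X" "y \<otimes> x = p A \<otimes> T_sum W c" "y \<otimes> x \<noteq> \<zero>"
    using reduction by metis
  have x': "p A \<otimes> T_sum W c \<in> I"
    using y(1,6) \<open>x \<in> I\<close> I by (metis left_ideal_def)
  have restrict: "p D \<otimes> T_sum W c \<in> I" if "D \<in> \<U> X" "D \<subseteq> A" for D
  proof -
    have "p D \<otimes> (p A \<otimes> T_sum W c) = p D \<otimes> T_sum W c"
      using y(2) that by (simp add: Int_absorb2)
    then show ?thesis using x' I that by (metis left_ideal_def p_closed)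
  qed
  have AX: "\<beta> \<frown> a \<in> X" if "\<beta> \<in> W" "a \<in> A" for \<beta> a
    using y(5) that by (auto simp: pull_def)
  have "A \<noteq> {}" "W \<noteq> {}" using y(2,6,7) by auto
  then obtain a \<beta>\<^sub>0 where a: "a \<in> A" "\<beta>\<^sub>0 \<in> W" by auto
  have "finite A"
  proof (rule ccontr)
    assume inf: "infinite A"
    \<comment> \<open>The points at which the indicator of \<open>\<beta>\<^sub>0 \<frown> a\<close>
      can be seen by some word of \<open>W\<close>, at most one for each word.\<close>
    let ?P = "\<Union>\<beta>\<in>W. {w. \<beta> \<frown> w = \<beta>\<^sub>0 \<frown> a}"
    have "finite {w. \<beta> \<frown> w = \<beta>\<^sub>0 \<frown> a}" for \<beta>
    proof (cases "\<exists>w. \<beta> \<frown> w = \<beta>\<^sub>0 \<frown> a")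
      case True
      then obtain w where "\<beta> \<frown> w = \<beta>\<^sub>0 \<frown> a" by blast
      then have "{w. \<beta> \<frown> w = \<beta>\<^sub>0 \<frown> a} \<subseteq> {w}"
        by (metis (mono_tags, lifting) insertI1 mem_Collect_eq same_concat_eq subsetI)
      then show ?thesis by (rule finite_subset) simp
    qed simp
    then have fin: "finite ?P" using y(3) by blast
    \<comment> \<open>The point \<open>a'\<close> keeps the cut element nonzero, while
      \<open>D\<close> avoids every point that sees the indicator.\<close>
    then obtain a' where a': "a' \<in> A" "a' \<notin> ?P" using inf by (metis finite_subset subsetI)
    then obtain D where D: "D \<in> \<U> X" "a' \<in> D" "D \<inter> ?P = {}"
      using separation[OF fin] U_subset[OF y(2)] by blast
    let ?z = "p (A \<inter> D) \<otimes> T_sum W c"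
    have U: "A \<inter> D \<in> \<U> X" using y D by simp
    have "?z \<in> I" using restrict[OF U] by simp
    moreover have "?z \<noteq> \<zero>"
      by (rule p_T_sum_nonzero[of W c \<beta>\<^sub>0 "A \<inter> D" a']) (use y(3,4) a a' D U AX in auto)
    ultimately obtain b where b: "b \<in> carrier B" "p A \<otimes> T_sum W c = b \<otimes> ?z"
      using minimal_left_ideal_cyclic[OF assms, of ?z] x' by blast
    let ?\<psi> = "\<delta> (\<beta>\<^sub>0 \<frown> a)"
    have \<psi>: "?\<psi> \<in> fun_space X" using a AX by (simp add: \<delta>_fun_space)
    have "act ?z ?\<psi> = (\<lambda>_. 0)"
    proof
      fix w
      have "\<beta> \<frown> w \<noteq> \<beta>\<^sub>0 \<frown> a" if "w \<in> A \<inter> D" "\<beta> \<in> W" for \<beta>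
        using that D by blast
      then show "act ?z ?\<psi> w = 0"
        using y(3) \<psi> U by (auto simp: act_p_T_sum act_T_sum \<delta>_def intro!: sum.neutral)
    qed
    moreover have "(\<lambda>_. 0) \<in> fun_space X" by (simp add: fun_space_def)
    \<comment> \<open>A left multiple of \<open>?z\<close> kills whatever \<open>?z\<close>
      kills.\<close>
    ultimately have "act (p A \<otimes> T_sum W c) ?\<psi> a = 0"
      unfolding b(2) using b(1) U \<psi> act_scale[of b "\<lambda>_. 0" 0 a] by (simp add: act_mult)
    then show False
      using act_T_sum_\<delta>[of W c \<beta>\<^sub>0 a] y(3,4) AX a y(2) \<psi> by (simp add: act_p_T_sum)
  qed
  then have "{a} \<in> \<U> X" using singleton_U y(2) a by blast
  then show thesis
    by (rule that[of a W c]) (use y(3,4) AX a restrict[of "{a}"] \<open>{a} \<in> \<U> X\<close> \<open>W \<noteq> {}\<close> in \<open>simp_all\<close>)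
qed

lemma minimal_left_ideal_point_aperiodic:
  assumes I: "minimal_left_ideal I B" and W: "finite W" "W \<noteq> {}" "\<And>\<beta>. \<beta> \<in> W \<Longrightarrow> c \<beta> \<noteq> 0"
    and q: "{q} \<in> \<U> X" "\<And>\<beta>. \<beta> \<in> W \<Longrightarrow> \<beta> \<frown> q \<in> X" and x: "p {q} \<otimes> T_sum W c \<in> I"
  shows "\<not> eventually_periodic q"
proof
  assume "eventually_periodic q"
  then obtain \<alpha> \<gamma> where \<gamma>: "\<gamma> \<noteq> []" "q = \<alpha> \<frown> \<gamma>\<^sup>\<omega>" by (auto simp: eventually_periodic_def)
  define z x m where "z = \<gamma>\<^sup>\<omega>" and "x = p {q} \<otimes> T_sum W c" and "m = length \<gamma>"
  \<comment> \<open>\<open>T \<alpha>\<close> evaluates at \<open>\<alpha> \<frown> y\<close> and so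
    moves the support from \<open>q\<close> to the purely periodic point \<open>z\<close>. By
    minimality \<open>x'\<close> will be a left multiple of \<open>x''\<close>.\<close>
  define x' x'' where "x' = T \<alpha> \<otimes> x" and "x'' = (\<one> \<ominus> T \<gamma>) \<otimes> x'"
  have mult_I: "b \<otimes> y \<in> I" if "b \<in> carrier B" "y \<in> I" for b y
    using I that by (auto simp: minimal_left_ideal_def left_ideal_def)
  have carr: "x \<in> carrier B" "x' \<in> carrier B" "x'' \<in> carrier B"
    using q(1) by (simp_all add: x_def x'_def x''_def)
  have mem: "x' \<in> I" "x'' \<in> I"
    using x mult_I by (simp_all add: x_def[symmetric] x'_def x''_def)
  have zX: "z \<in> X"
    using U_subset[OF q(1)] \<gamma> suffix_closed[of \<alpha> z] by (simp add: z_def)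
  obtain \<beta>\<^sub>0 where \<beta>\<^sub>0: "\<beta>\<^sub>0 \<in> W" using W by blast
  \<comment> \<open>By \<open>act_T_sum_\<delta>\<close> this indicator gives a nonzero value at
    \<open>q\<close>, which becomes the factor \<open>g\<close>.\<close>
  define \<psi> where "\<psi> = \<delta> (\<beta>\<^sub>0 \<frown> q)"
  have \<psi>: "\<psi> \<in> fun_space X" using q(2)[OF \<beta>\<^sub>0] by (simp add: \<psi>_def \<delta>_fun_space)
  define g where "g = (1 + fps_X) ^ length \<alpha> * act (T_sum W c) \<psi> q"
  have "(1 + fps_X :: 'r fps) \<noteq> 0"
    using one_plus_X_power_neq_1[of 1, where ?'r = 'r] 
    by (metis add.right_neutral add_0 fps_X_nth fps_add_nth fps_one_nth fps_zero_nth zero_neq_one)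
  then have g: "g \<noteq> 0"
    using act_T_sum_\<delta>[OF W(1,3) \<beta>\<^sub>0 q(2)[OF \<beta>\<^sub>0]] by (simp add: g_def \<psi>_def)
  have x'_act: "act x' \<psi> y = g * \<delta> z y" for y
    using carr(1) \<psi> q(1) \<gamma>(2)
    by (simp add: x'_def act_mult act_closed act_T) (simp add: x_def act_p_T_sum g_def \<delta>_def z_def)
  \<comment> \<open>Only \<open>z\<close> is sent to \<open>z\<close> by prefixing
    \<open>\<gamma>\<close>, so \<open>T \<gamma>\<close> acts on \<open>g * \<delta> z\<close> as
    multiplication by \<open>(1 + fps_X) ^ m\<close>.\<close>
  have "\<gamma> \<frown> y = z \<longleftrightarrow> y = z" for y
    using iter_unroll[of \<gamma>] \<gamma>(1) same_concat_eq[of \<gamma> y z] by (simp add: z_def)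
  then have "act (T \<gamma> \<otimes> x') \<psi> y = (1 + fps_X) ^ m * g * \<delta> z y" for y
    using carr(2) \<psi> by (simp add: act_mult act_closed act_T x'_act m_def \<delta>_def)
  moreover have "x'' \<oplus> T \<gamma> \<otimes> x' = x'"
    using carr(2) by (simp add: x''_def minus_eq l_distr l_minus a_assoc l_neg)
  ultimately have "act x'' \<psi> y + (1 + fps_X) ^ m * g * \<delta> z y = g * \<delta> z y" for y
    using act_add[of x'' "T \<gamma> \<otimes> x'" \<psi> y] carr \<psi> x'_act[of y] by simp
  then have x''_act: "act x'' \<psi> y = ((1 - (1 + fps_X) ^ m) * g) * \<delta> z y" for y
    by (simp add: algebra_simps eq_diff_eq)
  have "x'' \<noteq> \<zero>"
  proof
    assume "x'' = \<zero>"
    then have "(1 - (1 + fps_X) ^ m) * g = 0"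
      using x''_act[of z] act_zero[OF \<psi>, of z] by (simp add: \<delta>_def)
    then show False
      using g one_plus_X_power_neq_1[of m, where ?'r = 'r] \<gamma>(1) by (simp add: m_def)
  qed
  then obtain b where b: "b \<in> carrier B" "x' = b \<otimes> x''"
    using minimal_left_ideal_cyclic[OF I mem(2)] mem(1) by blast
  have "g = act b (act x'' \<psi>) z"
    using x'_act[of z] act_mult[OF b(1) carr(3) \<psi>] b(2) by (simp add: \<delta>_def)
  also have "act x'' \<psi> = (\<lambda>y. ((1 - (1 + fps_X) ^ m) * g) * \<delta> z y)"
    using x''_act by blast
  \<comment> \<open>Linearity over the power series extracts the factor from an arbitrary
    \<open>b\<close>.\<close>
  also have "act b \<dots> z = ((1 - (1 + fps_X) ^ m) * g) * act b (\<delta> z) z"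
    by (rule act_scale) (use b zX \<delta>_fun_space in auto)
  finally have "g * 1 = g * ((1 - (1 + fps_X) ^ m) * act b (\<delta> z) z)"
    by (simp add: mult_ac)
  \<comment> \<open>The factor \<open>1 - (1 + fps_X) ^ m\<close> has constant coefficient 0, so
    comparison of constant coefficients gives \<open>1 = 0\<close>.\<close>
  then have "fps_nth (1 :: 'r fps) 0 = fps_nth ((1 - (1 + fps_X) ^ m) * act b (\<delta> z) z) 0"
    using g by (simp only: mult_cancel_left) simp
  then show False
    by (simp add: fps_power_zeroth)
qed

lemma left_ideal_p_ideal: "A \<in> \<Q> X \<Longrightarrow> left_ideal (p_ideal A) B"
  by (erule Q_E) (simp add: left_ideal_principal)

theorem left_socle_eq: "left_socle B = sum_left_ideals B (\<Q> X) p_ideal"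
proof
  let ?S = "sum_left_ideals B (\<Q> X) p_ideal"
  have ideal: "left_ideal (p_ideal A) B" if "A \<in> \<Q> X" for A
    using left_ideal_p_ideal that .
  have S_add: "x \<oplus> y \<in> ?S" if "x \<in> ?S" "y \<in> ?S" for x y
    by (rule sum_left_ideals_add[OF ideal that])
  have S_carrier: "?S \<subseteq> carrier B"
    by (rule sum_left_ideals_closed[OF ideal])
  have "I \<subseteq> ?S" if I: "minimal_left_ideal I B" for I
  proof -
    obtain q W c where q: "{q} \<in> \<U> X" "finite W" "W \<noteq> {}" "\<And>\<beta>. \<beta> \<in> W \<Longrightarrow> c \<beta> \<noteq> 0"
        "\<And>\<beta>. \<beta> \<in> W \<Longrightarrow> \<beta> \<frown> q \<in> X" "p {q} \<otimes> T_sum W c \<in> I"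
      by (rule minimal_left_ideal_point[OF I], rule that)
    have aper: "\<not> eventually_periodic q"
      by (rule minimal_left_ideal_point_aperiodic[OF I q(2,3) _ q(1) _ q(6)]) (use q in auto)
    \<comment> \<open>Stated for all subsets of \<open>W\<close>, so that induction can add one word
      at a time.\<close>
    have "p {q} \<otimes> T_sum W' c \<in> ?S" if "finite W'" "W' \<subseteq> W" for W'
      using that
    proof (induction W' rule: finite_induct)
      case empty
      then show ?case using q(1) by (simp add: sum_left_ideals_zero)
    next
      case (insert \<beta> W')
      have \<beta>: "{\<beta> \<frown> q} = push X \<beta> {q}" using q(5) insert.prems by (simp add: push_singleton)
      then have U: "{\<beta> \<frown> q} \<in> \<U> X" using q(1) U_push by metis
      \<comment> \<open>\<open>q\<close> is a suffix of \<open>\<beta> \<frown> q\<close>, so the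
        longer sequence is aperiodic too.\<close>
      have Q: "{\<beta> \<frown> q} \<in> \<Q> X"
        using U aper eventually_periodic_suffix by (auto simp: Q_singleton_iff)
      have "p {q} \<otimes> (k (c \<beta>) \<otimes> T \<beta>) = (k (c \<beta>) \<otimes> T \<beta>) \<otimes> p {\<beta> \<frown> q}"
        using q(1) U by (simp add: k_left_comm p_T \<beta>[symmetric] m_assoc)
      then have "p {q} \<otimes> (k (c \<beta>) \<otimes> T \<beta>) \<in> p_ideal {\<beta> \<frown> q}" by auto
      then have "p {q} \<otimes> (k (c \<beta>) \<otimes> T \<beta>) \<in> ?S"
        using q(1) by (intro sum_left_ideals_mem[OF Q]) auto
      moreover have "p {q} \<otimes> T_sum (insert \<beta> W') c =
          p {q} \<otimes> (k (c \<beta>) \<otimes> T \<beta>) \<oplus> p {q} \<otimes> T_sum W' c"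
        using insert.hyps q(1) by (simp add: T_sum_insert r_distr)
      ultimately show ?case using insert S_add by simp
    qed
    then have x: "p {q} \<otimes> T_sum W c \<in> ?S" using q(2) by simp
    obtain \<beta>\<^sub>0 where "\<beta>\<^sub>0 \<in> W" using q(3) by blast
    then have "p {q} \<otimes> T_sum W c \<noteq> \<zero>"
      using p_T_sum_nonzero[of W c \<beta>\<^sub>0 "{q}" q] q by blast
    \<comment> \<open>A single nonzero element generates \<open>I\<close>, so its membership in the
      sum is enough.\<close>
    then have "I = {b \<otimes> (p {q} \<otimes> T_sum W c) | b. b \<in> carrier B}"
      using minimal_left_ideal_cyclic[OF I q(6)] by simp
    then show ?thesis
      using sum_left_ideals_mult[OF ideal x] by auto
  qed
  then show "left_socle B \<subseteq> ?S"
    unfolding left_socle_def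
    by (intro sum_left_ideals_least[OF _ sum_left_ideals_zero S_carrier S_add]) auto
  have min_ideal: "left_ideal I B" if "I \<in> {I. minimal_left_ideal I B}" for I
    using that by (simp add: minimal_left_ideal_def)
  show "?S \<subseteq> left_socle B"
  proof (rule sum_left_ideals_least)
    fix A x assume "A \<in> \<Q> X" "x \<in> p_ideal A"
    then show "x \<in> left_socle B"
      unfolding left_socle_def
      using sum_left_ideals_mem[of "p_ideal A" "{I. minimal_left_ideal I B}" x "\<lambda>I. I"]
        minimal_left_ideal_p_ideal left_ideal_subset[OF ideal] by auto
  next
    fix x y assume "x \<in> left_socle B" "y \<in> left_socle B"
    then show "x \<oplus> y \<in> left_socle B"
      unfolding left_socle_def by (intro sum_left_ideals_add min_ideal)
  next
    show "\<zero> \<in> left_socle B" unfolding left_socle_def by (rule sum_left_ideals_zero)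
    show "left_socle B \<subseteq> carrier B"
      unfolding left_socle_def by (rule sum_left_ideals_closed[OF min_ideal])
  qed
qed

end

section \<open>Algebras given by generators and relations\<close>

lemma free_algebra_simps:
  "\<zero>\<^bsub>free_algebra G\<^esub> = (\<lambda>w. 0)"
  "\<one>\<^bsub>free_algebra G\<^esub> = monomial []"
  "f \<oplus>\<^bsub>free_algebra G\<^esub> g = (\<lambda>w. f w + g w)"
  unfolding free_algebra_def monomial_def by simp_all

lemma free_algebra_carrier:
  "f \<in> carrier (free_algebra G) \<longleftrightarrow> finite {w. f w \<noteq> 0} \<and> (\<forall>w. f w \<noteq> 0 \<longrightarrow> set w \<subseteq> G)"
  by (simp add: free_algebra_def)

lemma free_algebra_minus:
  fixes f g :: "'g list \<Rightarrow> 'r::comm_ring_1"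
  assumes "f \<in> carrier (free_algebra G)" "g \<in> carrier (free_algebra G)"
  shows "f \<ominus>\<^bsub>free_algebra G\<^esub> g = (\<lambda>w. f w - g w)"
proof -
  interpret ring "free_algebra G :: ('g list \<Rightarrow> 'r) ring" by (rule ring_free_algebra)
  have "(\<lambda>w. - g w) \<in> carrier (free_algebra G)"
    using assms by (simp add: free_algebra_carrier)
  then have "\<ominus>\<^bsub>free_algebra G\<^esub> g = (\<lambda>w. - g w)"
    using assms(2) by (intro minus_equality) (simp_all add: free_algebra_simps)
  then show ?thesis by (simp add: a_minus_def free_algebra_simps)
qed

definition scaled :: "'r::comm_ring_1 \<Rightarrow> 'g list \<Rightarrow> 'g list \<Rightarrow> 'r" where
  "scaled c w = (\<lambda>v. if v = w then c else 0)"

lemma monomial_scaled: "monomial w = scaled 1 w"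
  by (simp add: monomial_def scaled_def)

lemma scaled_carrier [simp]:
  assumes "set w \<subseteq> G"
  shows "scaled c w \<in> carrier (free_algebra G)"
proof -
  have *: "v = w" if "scaled c w v \<noteq> 0" for v
    using that by (simp add: scaled_def split: if_splits)
  have "{v. scaled c w v \<noteq> 0} \<subseteq> {w}"
  proof
    fix v assume "v \<in> {v. scaled c w v \<noteq> 0}"
    then show "v \<in> {w}" using *[of v] by simp
  qed
  then have "finite {v. scaled c w v \<noteq> 0}"
    by (rule finite_subset) simp
  moreover have "set v \<subseteq> G" if "scaled c w v \<noteq> 0" for v
    using *[OF that] assms by simp
  ultimately show ?thesis
    unfolding free_algebra_carrier by (intro conjI allI impI)
qed

lemma monomial_carrier [simp]: "set w \<subseteq> G \<Longrightarrow> monomial w \<in> carrier (free_algebra G)"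
  by (simp add: monomial_scaled)

lemma scaled_mult:
  "scaled c u \<otimes>\<^bsub>free_algebra G\<^esub> scaled d v = scaled (c * d) (u @ v)"
proof
  fix w
  have "(scaled c u \<otimes>\<^bsub>free_algebra G\<^esub> scaled d v) w =
      (\<Sum>i\<le>length w. if i = length u then if w = u @ v then c * d else 0 else 0)"
    unfolding free_algebra_def scaled_def monoid.simps
  proof (rule sum.cong[OF refl])
    fix i assume i: "i \<in> {..length w}"
    have "take i w = u \<and> drop i w = v \<longleftrightarrow> i = length u \<and> w = u @ v"
    proof
      assume *: "take i w = u \<and> drop i w = v"
      then have "length u = i" using i by (metis atMost_iff length_take min_absorb2)
      moreover have "u @ v = w" using * append_take_drop_id by metis
      ultimately show "i = length u \<and> w = u @ v" by blast
    qed simp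
    then show "(if take i w = u then c else 0) * (if drop i w = v then d else 0) =
        (if i = length u then if w = u @ v then c * d else 0 else 0)"
      by (cases "take i w = u"; cases "drop i w = v"; simp only: if_True if_False mult_zero_left mult_zero_right; presburger)
  qed
  also have "\<dots> = scaled (c * d) (u @ v) w"
    by (cases "w = u @ v") (simp_all add: scaled_def)
  finally show "(scaled c u \<otimes>\<^bsub>free_algebra G\<^esub> scaled d v) w = scaled (c * d) (u @ v) w" .
qed

lemma monomial_mult: "monomial u \<otimes>\<^bsub>free_algebra G\<^esub> monomial v = monomial (u @ v)"
  by (simp add: monomial_scaled scaled_mult)

text \<open>Induction on the size of the support, removing one word at a time.\<close>

lemma free_algebra_induct [consumes 1, case_names zero add]:
  assumes "f \<in> carrier (free_algebra G)" and zero: "P (\<lambda>w. 0)"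
    and add: "\<And>c w f. set w \<subseteq> G \<Longrightarrow> f \<in> carrier (free_algebra G) \<Longrightarrow> P f \<Longrightarrow>
      P (scaled c w \<oplus>\<^bsub>free_algebra G\<^esub> f)"
  shows "P f"
  using assms(1)
proof (induction "card {w. f w \<noteq> 0}" arbitrary: f)
  case 0
  then have "f = (\<lambda>w. 0)" by (auto simp: free_algebra_carrier)
  then show ?case using zero by simp
next
  case (Suc n)
  then have "{w. f w \<noteq> 0} \<noteq> {}" by (intro notI) simp
  then obtain w where w: "f w \<noteq> 0" by blast
  define g where "g = f(w := 0)"
  have supp: "{v. g v \<noteq> 0} = {v. f v \<noteq> 0} - {w}" by (auto simp: g_def)
  have "set v \<subseteq> G" if "g v \<noteq> 0" for v
    using that Suc.prems unfolding g_def free_algebra_carrier by (metis fun_upd_apply)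
  then have "g \<in> carrier (free_algebra G)"
    using Suc.prems unfolding free_algebra_carrier supp by simp
  moreover have "card {v. g v \<noteq> 0} = n"
    unfolding supp using Suc.hyps(2)[symmetric] Suc.prems w by (simp add: free_algebra_carrier)
  ultimately have "P (scaled (f w) w \<oplus>\<^bsub>free_algebra G\<^esub> g)"
    using Suc.hyps(1)[of g] Suc.prems w by (intro add) (simp_all add: free_algebra_carrier)
  moreover have "scaled (f w) w \<oplus>\<^bsub>free_algebra G\<^esub> g = f"
    by (auto simp: free_algebra_simps scaled_def g_def)
  ultimately show ?case by simp
qed

locale presentation =
  fixes G :: "'g set" and Rel :: "(('g list \<Rightarrow> 'r::comm_ring_1) \<times> ('g list \<Rightarrow> 'r)) set"
  assumes relations_carrier: "(f, g) \<in> Rel \<Longrightarrow>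
    f \<in> carrier (free_algebra G) \<and> g \<in> carrier (free_algebra G)"
begin

abbreviation FA :: "('g list \<Rightarrow> 'r) ring" where "FA \<equiv> free_algebra G"

abbreviation PA :: "('g list \<Rightarrow> 'r) set ring" where "PA \<equiv> presented_algebra G Rel"

definition proj :: "('g list \<Rightarrow> 'r) \<Rightarrow> ('g list \<Rightarrow> 'r) set" where
  "proj f = relation_ideal G Rel +>\<^bsub>FA\<^esub> f"

sublocale FA: ring FA by (rule ring_free_algebra)

lemma relations_subset: "{f \<ominus>\<^bsub>FA\<^esub> g | f g. (f, g) \<in> Rel} \<subseteq> carrier FA"
  using relations_carrier FA.minus_closed by blast

lemma relation_ideal: "ideal (relation_ideal G Rel) FA"
  unfolding relation_ideal_def by (rule FA.genideal_ideal[OF relations_subset])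

sublocale PA: ring PA
  unfolding presented_algebra_def by (rule ideal.quotient_is_ring[OF relation_ideal])

section \<open>The quotient map\<close>

lemma proj_hom: "proj \<in> ring_hom FA PA"
  using ideal.rcos_ring_hom[OF relation_ideal] unfolding proj_def presented_algebra_def .

lemma proj_closed [simp]: "f \<in> carrier FA \<Longrightarrow> proj f \<in> carrier PA"
  by (rule ring_hom_closed[OF proj_hom])

lemma proj_mult: "f \<in> carrier FA \<Longrightarrow> g \<in> carrier FA \<Longrightarrow>
    proj (f \<otimes>\<^bsub>FA\<^esub> g) = proj f \<otimes>\<^bsub>PA\<^esub> proj g"
  by (rule ring_hom_mult[OF proj_hom])

lemma proj_add: "f \<in> carrier FA \<Longrightarrow> g \<in> carrier FA \<Longrightarrow>
    proj (f \<oplus>\<^bsub>FA\<^esub> g) = proj f \<oplus>\<^bsub>PA\<^esub> proj g"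
  by (rule ring_hom_add[OF proj_hom])

lemma proj_one: "proj (monomial []) = \<one>\<^bsub>PA\<^esub>"
  using ring_hom_one[OF proj_hom] by (simp add: free_algebra_simps)

lemma proj_zero: "proj (\<lambda>w. 0) = \<zero>\<^bsub>PA\<^esub>"
  using ring_hom_zero[OF proj_hom ring_free_algebra PA.ring_axioms] by (simp add: free_algebra_simps)

lemma carrier_PA: "carrier PA = proj ` carrier FA"
  unfolding presented_algebra_def proj_def FactRing_def by (auto simp: A_RCOSETS_def')

lemma proj_eq_iff: "f \<in> carrier FA \<Longrightarrow> g \<in> carrier FA \<Longrightarrow>
    proj f = proj g \<longleftrightarrow> (\<lambda>w. f w - g w) \<in> relation_ideal G Rel"
  using FA.quotient_eq_iff_same_a_r_cos[OF relation_ideal, of f g]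
  by (simp add: proj_def free_algebra_minus)

lemma relation_ideal_least:
  assumes "ideal J FA" "\<And>f g. (f, g) \<in> Rel \<Longrightarrow> (\<lambda>w. f w - g w) \<in> J"
  shows "relation_ideal G Rel \<subseteq> J"
proof -
  have "{f \<ominus>\<^bsub>FA\<^esub> g | f g. (f, g) \<in> Rel} \<subseteq> J"
    using assms(2) relations_carrier by (auto simp: free_algebra_minus)
  then show ?thesis
    unfolding relation_ideal_def using assms(1) by (intro FA.genideal_minimal)
qed

lemma proj_relation: "(f, g) \<in> Rel \<Longrightarrow> proj f = proj g"
proof -
  assume fg: "(f, g) \<in> Rel"
  have "{f \<ominus>\<^bsub>FA\<^esub> g | f g. (f, g) \<in> Rel} \<subseteq> relation_ideal G Rel"
    unfolding relation_ideal_def by (rule FA.genideal_self[OF relations_subset])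
  then have "f \<ominus>\<^bsub>FA\<^esub> g \<in> relation_ideal G Rel" using fg by blast
  then show ?thesis
    using relations_carrier[OF fg] by (simp add: proj_eq_iff free_algebra_minus)
qed

lemma proj_monomial_Cons:
  "set (x # w) \<subseteq> G \<Longrightarrow> proj (monomial (x # w)) = proj (monomial [x]) \<otimes>\<^bsub>PA\<^esub> proj (monomial w)"
  using proj_mult[of "monomial [x]" "monomial w"] by (simp add: monomial_mult)

lemma proj_monomial:
  "set w \<subseteq> G \<Longrightarrow> proj (monomial w) = lprod PA (map (\<lambda>x. proj (monomial [x])) w)"
proof (induction w)
  case (Cons x w)
  then show ?case using proj_monomial_Cons[of x w] by simp
qed (simp add: proj_one)

lemma proj_scaled:
  "set w \<subseteq> G \<Longrightarrow> proj (scaled c w) = proj (scaled c []) \<otimes>\<^bsub>PA\<^esub> proj (monomial w)"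
  using proj_mult[of "scaled c []" "monomial w"] by (simp add: monomial_scaled scaled_mult)

lemma scaled_Nil_comm:
  "f \<in> carrier FA \<Longrightarrow> f \<otimes>\<^bsub>FA\<^esub> scaled c [] = scaled c [] \<otimes>\<^bsub>FA\<^esub> f"
proof (induction rule: free_algebra_induct)
  case zero
  then show ?case
    using FA.l_null[of "scaled c []"] FA.r_null[of "scaled c []"] by (simp add: free_algebra_simps(1))
next
  case (add d w f)
  then show ?case by (simp add: FA.l_distr FA.r_distr scaled_mult mult.commute)
qed

end

text \<open>Weighted shifts: adjoint letters carry the weight \<open>1 + fps_X\<close> and letters
  its inverse. The weights balance in every relation, while adjoint words of different lengths
  receive different powers.\<close>

primrec gen_act :: "'a word set \<Rightarrow> 'a generator \<Rightarrow> ('a word \<Rightarrow> 'r::field fps) \<Rightarrow> 'a word \<Rightarrow> 'r fps" where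
  "gen_act X (Gen_p A) \<phi> = (\<lambda>x. if x \<in> A then \<phi> x else 0)"
| "gen_act X (Gen_s a) \<phi> =
    (\<lambda>x. if x \<in> X \<and> x 0 = a then inverse (1 + fps_X) * \<phi> (suffix 1 x) else 0)"
| "gen_act X (Gen_s_star a) \<phi> = (\<lambda>x. (1 + fps_X) * \<phi> (a ## x))"

primrec word_act :: "'a word set \<Rightarrow> 'a generator list \<Rightarrow> ('a word \<Rightarrow> 'r::field fps) \<Rightarrow> 'a word \<Rightarrow> 'r fps" where
  "word_act X [] \<phi> = \<phi>"
| "word_act X (g # w) \<phi> = gen_act X g (word_act X w \<phi>)"

definition alg_act :: "'a word set \<Rightarrow> ('a generator list \<Rightarrow> 'r::field) \<Rightarrow> ('a word \<Rightarrow> 'r fps) \<Rightarrow> 'a word \<Rightarrow> 'r fps" where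
  "alg_act X f \<phi> x = (\<Sum>w | f w \<noteq> 0. fps_const (f w) * word_act X w \<phi> x)"

lemma word_act_append: "word_act X (u @ v) \<phi> = word_act X u (word_act X v \<phi>)"
  by (induction u) auto

lemma gen_act_linear:
  "gen_act X g (\<lambda>x. c * \<phi> x + \<psi> x) x = c * gen_act X g \<phi> x + gen_act X g \<psi> x"
  by (cases g) (auto simp: algebra_simps)

lemma word_act_linear:
  "word_act X w (\<lambda>x. c * \<phi> x + \<psi> x) x = c * word_act X w \<phi> x + word_act X w \<psi> x"
proof (induction w arbitrary: x)
  case (Cons g w)
  then have "word_act X w (\<lambda>x. c * \<phi> x + \<psi> x) = (\<lambda>x. c * word_act X w \<phi> x + word_act X w \<psi> x)"
    by blast
  then show ?case by (simp add: gen_act_linear)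
qed simp

lemma word_act_zero [simp]: "word_act X w (\<lambda>x. 0) = (\<lambda>x. 0)"
proof (induction w)
  case (Cons g w)
  then show ?case by (cases g) (simp_all add: fun_eq_iff)
qed simp

text \<open>Allows a common index set for two elements even when coefficients of their sum
  cancel.\<close>

lemma alg_act_superset:
  "finite W \<Longrightarrow> {w. f w \<noteq> 0} \<subseteq> W \<Longrightarrow>
    alg_act X f \<phi> x = (\<Sum>w\<in>W. fps_const (f w) * word_act X w \<phi> x)"
  unfolding alg_act_def by (rule sum.mono_neutral_left) auto

lemma alg_act_zero [simp]: "alg_act X (\<lambda>w. 0) \<phi> x = 0"
  by (simp add: alg_act_def)

lemma alg_act_scaled: "alg_act X (scaled c w) \<phi> x = fps_const c * word_act X w \<phi> x"
  by (subst alg_act_superset[of "{w}"]) (auto simp: scaled_def)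

lemma alg_act_monomial: "alg_act X (monomial w) \<phi> x = word_act X w \<phi> x"
  by (simp add: monomial_scaled alg_act_scaled)

lemma alg_act_add:
  assumes "f \<in> carrier (free_algebra G)" "g \<in> carrier (free_algebra G)"
  shows "alg_act X (f \<oplus>\<^bsub>free_algebra G\<^esub> g) \<phi> x = alg_act X f \<phi> x + alg_act X g \<phi> x"
proof -
  let ?W = "{w. f w \<noteq> 0} \<union> {w. g w \<noteq> 0}"
  have fin: "finite ?W" using assms by (simp add: free_algebra_carrier)
  have "alg_act X (\<lambda>w. f w + g w) \<phi> x = (\<Sum>w\<in>?W. fps_const (f w + g w) * word_act X w \<phi> x)"
    by (rule alg_act_superset[OF fin]) auto
  also have "\<dots> = (\<Sum>w\<in>?W. fps_const (f w) * word_act X w \<phi> x) +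
      (\<Sum>w\<in>?W. fps_const (g w) * word_act X w \<phi> x)"
    by (simp add: sum.distrib[symmetric] fps_const_add[symmetric] distrib_right del: fps_const_add)
  also have "\<dots> = alg_act X f \<phi> x + alg_act X g \<phi> x"
    using alg_act_superset[OF fin, of f X \<phi> x] alg_act_superset[OF fin, of g X \<phi> x] by auto
  finally show ?thesis by (simp add: free_algebra_simps)
qed

lemma alg_act_linear:
  "alg_act X f (\<lambda>x. c * \<phi> x + \<psi> x) x = c * alg_act X f \<phi> x + alg_act X f \<psi> x"
  unfolding alg_act_def word_act_linear
  by (simp add: sum_distrib_left sum.distrib distrib_left mult.left_commute)

lemma alg_act_zero_fun: "alg_act X f (\<lambda>x. 0) x = 0"
  by (simp add: alg_act_def)

lemma alg_act_scaled_mult: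
  fixes g :: "'a generator list \<Rightarrow> 'r::field"
  assumes "g \<in> carrier (free_algebra G)" "set u \<subseteq> G"
  shows "alg_act X (scaled c u \<otimes>\<^bsub>free_algebra G\<^esub> g) \<phi> x = fps_const c * word_act X u (alg_act X g \<phi>) x"
  using assms(1)
proof (induction rule: free_algebra_induct)
  case zero
  interpret ring "free_algebra G :: ('a generator list \<Rightarrow> 'r) ring" by (rule ring_free_algebra)
  have "alg_act X (\<lambda>w. 0) \<phi> = (\<lambda>x. 0)" by auto
  then show ?case using r_null[of "scaled c u"] assms(2) by (simp add: free_algebra_simps)
next
  case (add d v g)
  interpret ring "free_algebra G :: ('a generator list \<Rightarrow> 'r) ring" by (rule ring_free_algebra)
  have uv: "set (u @ v) \<subseteq> G" using add assms by simp
  have eq: "alg_act X (scaled d v \<oplus>\<^bsub>free_algebra G\<^esub> g) \<phi> =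
      (\<lambda>x. fps_const d * word_act X v \<phi> x + alg_act X g \<phi> x)"
    using add by (simp add: alg_act_add[where G = G] alg_act_scaled fun_eq_iff)
  have "alg_act X (scaled c u \<otimes>\<^bsub>free_algebra G\<^esub> (scaled d v \<oplus>\<^bsub>free_algebra G\<^esub> g)) \<phi> x =
      alg_act X (scaled (c * d) (u @ v)) \<phi> x + alg_act X (scaled c u \<otimes>\<^bsub>free_algebra G\<^esub> g) \<phi> x"
    using add assms uv by (simp only: r_distr scaled_carrier scaled_mult) (simp add: alg_act_add[where G = G])
  then show ?case
    unfolding eq by (simp add: add.IH alg_act_scaled word_act_append word_act_linear distrib_left
        fps_const_mult[symmetric] mult.assoc del: fps_const_mult)
qed

text \<open>Linearity in the left factor reduces to a single scaled word, for which
  \<open>alg_act_scaled_mult\<close> has done the induction on the right factor.\<close>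

lemma alg_act_mult:
  fixes f g :: "'a generator list \<Rightarrow> 'r::field"
  assumes "f \<in> carrier (free_algebra G)" "g \<in> carrier (free_algebra G)"
  shows "alg_act X (f \<otimes>\<^bsub>free_algebra G\<^esub> g) \<phi> x = alg_act X f (alg_act X g \<phi>) x"
  using assms(1)
proof (induction rule: free_algebra_induct)
  case zero
  interpret ring "free_algebra G :: ('a generator list \<Rightarrow> 'r) ring" by (rule ring_free_algebra)
  show ?case using l_null[of g] assms(2) by (simp add: free_algebra_simps)
next
  case (add c w f)
  interpret ring "free_algebra G :: ('a generator list \<Rightarrow> 'r) ring" by (rule ring_free_algebra)
  show ?case
    using add assms(2)
    by (simp add: l_distr alg_act_add[where G = G] alg_act_scaled alg_act_scaled_mult)
qed

section \<open>The representation on functions over the subshift\<close>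

lemma Gen_p_generator [simp]: "Gen_p A \<in> generators X \<longleftrightarrow> A \<in> \<U> X"
  by (auto simp: generators_def)

lemma Gen_s_generator [simp]: "Gen_s a \<in> generators X" "Gen_s_star a \<in> generators X"
  by (simp_all add: generators_def)

lemma word_generators [simp]:
  "set (s_word \<alpha>) \<subseteq> generators X" "set (sstar_word \<alpha>) \<subseteq> generators X"
  by (auto simp: s_word_def sstar_word_def)

text \<open>In terms of ring operations, membership in the carrier and additivity of the action and
  of the quotient map become applicable to this relation.\<close>

lemma join_conv:
  assumes "A \<in> \<U> X" "D \<in> \<U> X"
  shows "(\<lambda>w. monomial [Gen_p A] w + monomial [Gen_p D] w - monomial [Gen_p (A \<inter> D)] w :: 'r::comm_ring_1) =
    (monomial [Gen_p A] \<oplus>\<^bsub>free_algebra (generators X)\<^esub> monomial [Gen_p D])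
      \<ominus>\<^bsub>free_algebra (generators X)\<^esub> monomial [Gen_p (A \<inter> D)]"
proof -
  let ?F = "free_algebra (generators X) :: ('a generator list \<Rightarrow> 'r) ring"
  interpret ring ?F by (rule ring_free_algebra)
  have "monomial [Gen_p A] \<oplus>\<^bsub>?F\<^esub> monomial [Gen_p D] \<in> carrier ?F"
    "monomial [Gen_p (A \<inter> D)] \<in> carrier ?F"
    using assms \<U>.inter[OF assms] by (auto intro!: a_closed monomial_carrier)
  then show ?thesis by (simp add: free_algebra_minus) (simp add: free_algebra_simps)
qed

lemma presentation_relations:
  "presentation (generators X) (relations X :: (('a generator list \<Rightarrow> 'r::comm_ring_1) \<times> _) set)"
proof
  let ?F = "free_algebra (generators X) :: ('a generator list \<Rightarrow> 'r) ring"
  interpret ring ?F by (rule ring_free_algebra)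
  fix f g :: "'a generator list \<Rightarrow> 'r"
  assume "(f, g) \<in> relations X"
  then show "f \<in> carrier ?F \<and> g \<in> carrier ?F"
  proof cases
    case (join A D)
    then have "g \<in> carrier ?F"
      using join_conv[of A X D, where ?'r = 'r] \<U>.inter[of A X D] by simp
    then show ?thesis using join \<U>.union[of A X D] by simp
  next
    case zero
    then show ?thesis using U_empty[of X] zero_closed by (simp add: free_algebra_simps)
  next
    case (cyl \<alpha> \<beta>)
    then show ?thesis using \<U>.gen[of \<alpha> X \<beta>] by simp
  qed (simp_all add: \<U>.inter)
qed

lemma one_plus_X_inverse: "inverse (1 + fps_X :: 'r::field fps) * (1 + fps_X) = 1"
  by (rule inverse_mult_eq_1) simp

context shift_space
begin

lemma fun_space_eq_0: "\<phi> \<in> fun_space X \<Longrightarrow> x \<notin> X \<Longrightarrow> \<phi> x = 0"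
  by (simp add: fun_space_def)

lemma word_act_sstar_word:
  "word_act X (sstar_word \<alpha>) \<phi> x = (1 + fps_X) ^ length \<alpha> * \<phi> (\<alpha> \<frown> x)"
proof (induction \<alpha> arbitrary: \<phi>)
  case (Cons a \<alpha>)
  have "word_act X (sstar_word (a # \<alpha>)) \<phi> x = word_act X (sstar_word \<alpha>) (gen_act X (Gen_s_star a) \<phi>) x"
    by (simp add: sstar_word_def word_act_append)
  then show ?case by (simp add: Cons.IH mult_ac)
qed (simp add: sstar_word_def)

lemma word_act_s_word_outside: "\<phi> \<in> fun_space X \<Longrightarrow>
    x \<notin> X \<or> (\<forall>y. x \<noteq> \<alpha> \<frown> y) \<Longrightarrow> word_act X (s_word \<alpha>) \<phi> x = 0"
proof (induction \<alpha> arbitrary: x)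
  case Nil
  then show ?case using fun_space_eq_0 by (auto simp: s_word_def)
next
  case (Cons a \<alpha>)
  have "suffix 1 x \<notin> X \<or> (\<forall>y. suffix 1 x \<noteq> \<alpha> \<frown> y)" if "x \<in> X" "x 0 = a"
  proof -
    have "x = (a # \<alpha>) \<frown> y" if "suffix 1 x = \<alpha> \<frown> y" for y
      using build_first[of x] that \<open>x 0 = a\<close> by simp
    then show ?thesis using Cons.prems(2) that by blast
  qed
  then show ?case using Cons by (simp add: s_word_def)
qed

lemma word_act_s_word:
  "\<alpha> \<frown> y \<in> X \<Longrightarrow> word_act X (s_word \<alpha>) \<phi> (\<alpha> \<frown> y) = inverse (1 + fps_X) ^ length \<alpha> * \<phi> y"
proof (induction \<alpha>)
  case (Cons a \<alpha>)
  have "suffix 1 (a ## \<alpha> \<frown> y) = \<alpha> \<frown> y" by (simp add: fun_eq_iff)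
  moreover have "\<alpha> \<frown> y \<in> X" using Cons.prems build_closed by simp
  ultimately show ?case using Cons by (simp add: s_word_def mult_ac)
qed (simp add: s_word_def)

lemma gen_act_fun_space:
  assumes "\<phi> \<in> fun_space X" "g \<in> generators X"
  shows "gen_act X g \<phi> \<in> fun_space X"
proof (cases g)
  case (Gen_p A)
  then show ?thesis using assms U_subset[of A] by (auto simp: fun_space_def)
qed (use assms build_closed in \<open>auto simp: fun_space_def\<close>)

lemma word_act_fun_space:
  "\<phi> \<in> fun_space X \<Longrightarrow> set w \<subseteq> generators X \<Longrightarrow> word_act X w \<phi> \<in> fun_space X"
  by (induction w) (simp_all add: gen_act_fun_space)

lemma alg_act_fun_space:
  assumes "\<phi> \<in> fun_space X" "f \<in> carrier (free_algebra (generators X))"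
  shows "alg_act X f \<phi> \<in> fun_space X"
proof -
  have "word_act X w \<phi> x = 0" if "f w \<noteq> 0" "x \<notin> X" for w x
    using word_act_fun_space[of \<phi> w] fun_space_eq_0 assms that by (simp add: free_algebra_carrier)
  then show ?thesis by (simp add: fun_space_def alg_act_def)
qed

text \<open>Relation (iii) for the action: off the cylinder of \<open>\<beta>\<close> both sides
  vanish, and at \<open>\<beta> \<frown> y\<close> the middle factor tests whether
  \<open>\<alpha> \<frown> y \<in> X\<close> while all weights cancel.\<close>

lemma word_act_cyl:
  assumes "\<phi> \<in> fun_space X"
  shows "word_act X (s_word \<beta> @ sstar_word \<alpha> @ s_word \<alpha> @ sstar_word \<beta>) \<phi> x =
    (if x \<in> \<C> X \<alpha> \<beta> then \<phi> x else 0)"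
proof -
  define \<psi> where "\<psi> = word_act X (sstar_word \<beta>) \<phi>"
  have \<psi>: "\<psi> \<in> fun_space X" unfolding \<psi>_def using assms by (intro word_act_fun_space) auto
  define \<chi> where "\<chi> = word_act X (sstar_word \<alpha> @ s_word \<alpha>) \<psi>"
  have \<chi>: "\<chi> \<in> fun_space X" unfolding \<chi>_def using \<psi> by (intro word_act_fun_space) auto
  have eq: "word_act X (s_word \<beta> @ sstar_word \<alpha> @ s_word \<alpha> @ sstar_word \<beta>) \<phi> x = word_act X (s_word \<beta>) \<chi> x"
    by (simp add: \<chi>_def \<psi>_def word_act_append)
  show ?thesis
  proof (cases "x \<in> X \<and> (\<exists>y. x = \<beta> \<frown> y)")
    case True
    then obtain y where y: "x = \<beta> \<frown> y" "\<beta> \<frown> y \<in> X" by blast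
    have "\<chi> y = (if \<alpha> \<frown> y \<in> X then \<psi> y else 0)"
    proof (cases "\<alpha> \<frown> y \<in> X")
      case True
      have "\<chi> y = (inverse (1 + fps_X) * (1 + fps_X)) ^ length \<alpha> * \<psi> y"
        using True by (simp add: \<chi>_def word_act_append word_act_sstar_word word_act_s_word
            power_mult_distrib mult_ac)
      then show ?thesis using True by (simp add: one_plus_X_inverse)
    next
      case False
      then show ?thesis
        using word_act_s_word_outside[OF \<psi>, of "\<alpha> \<frown> y" \<alpha>]
        by (simp add: \<chi>_def word_act_append word_act_sstar_word)
    qed
    moreover have "word_act X (s_word \<beta>) \<chi> x = inverse (1 + fps_X) ^ length \<beta> * \<chi> y"
      using y by (simp add: word_act_s_word)
    moreover have "inverse (1 + fps_X) ^ length \<beta> * \<psi> y = (inverse (1 + fps_X) * (1 + fps_X)) ^ length \<beta> * \<phi> x"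
      by (simp add: \<psi>_def word_act_sstar_word y(1) power_mult_distrib mult_ac)
    moreover have "x \<in> \<C> X \<alpha> \<beta> \<longleftrightarrow> \<alpha> \<frown> y \<in> X"
      using y by (auto simp: \<C>_def)
    ultimately show ?thesis unfolding eq by (simp add: one_plus_X_inverse)
  next
    case False
    moreover have "x \<notin> \<C> X \<alpha> \<beta>" using False by (auto simp: \<C>_def)
    ultimately show ?thesis
      unfolding eq using word_act_s_word_outside[OF \<chi>, of x \<beta>] by auto
  qed
qed

lemma alg_act_relation:
  assumes "(f, g) \<in> relations X" "\<phi> \<in> fun_space X"
  shows "alg_act X f \<phi> x = alg_act X (g :: 'a generator list \<Rightarrow> 'r::field) \<phi> x"
  using assms(1)
proof cases
  case unit
  \<comment> \<open>\<open>Gen_p X\<close> acts as the identity because \<open>\<phi>\<close>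
    vanishes off \<open>X\<close>.\<close>
  then show ?thesis using assms(2) fun_space_eq_0 by (auto simp: alg_act_monomial)
next
  case (meet A D)
  then show ?thesis by (auto simp: alg_act_monomial)
next
  case (join A D)
  let ?F = "free_algebra (generators X) :: ('a generator list \<Rightarrow> 'r) ring"
  interpret ring ?F by (rule ring_free_algebra)
  let ?h = "monomial [Gen_p A] \<oplus>\<^bsub>?F\<^esub> monomial [Gen_p D]" and ?m = "monomial [Gen_p (A \<inter> D)]"
  have m: "monomial [Gen_p A] \<in> carrier ?F" "monomial [Gen_p D] \<in> carrier ?F" "?m \<in> carrier ?F"
    using join by simp_all
  \<comment> \<open>Additivity is known for sums, so the difference is evaluated by adding
    \<open>?m\<close> back.\<close>
  then have "alg_act X (?h \<ominus>\<^bsub>?F\<^esub> ?m) \<phi> x + alg_act X ?m \<phi> x = alg_act X (?h \<ominus>\<^bsub>?F\<^esub> ?m \<oplus>\<^bsub>?F\<^esub> ?m) \<phi> x"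
    by (simp add: alg_act_add[where G = "generators X"])
  also have "?h \<ominus>\<^bsub>?F\<^esub> ?m \<oplus>\<^bsub>?F\<^esub> ?m = ?h"
    using m by (simp add: minus_eq a_assoc l_neg)
  also have "alg_act X ?h \<phi> x = alg_act X (monomial [Gen_p A]) \<phi> x + alg_act X (monomial [Gen_p D]) \<phi> x"
    using m by (simp add: alg_act_add[where G = "generators X"])
  finally have "alg_act X (?h \<ominus>\<^bsub>?F\<^esub> ?m) \<phi> x =
      alg_act X (monomial [Gen_p A]) \<phi> x + alg_act X (monomial [Gen_p D]) \<phi> x - alg_act X ?m \<phi> x"
    by (simp add: eq_diff_eq)
  then show ?thesis
    unfolding join(1,2) join_conv[OF join(3,4)] by (simp add: alg_act_monomial)
next
  case zero
  then show ?thesis by (simp add: alg_act_monomial)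
next
  case (s a)
  have "a ## suffix 1 x = x" if "x 0 = a" using build_first[of x] that by simp
  then show ?thesis
    using s one_plus_X_inverse[where ?'r = 'r] by (simp add: alg_act_monomial mult.assoc[symmetric] del: One_nat_def)
next
  case (sstar a)
  \<comment> \<open>If \<open>a ## x\<close> is outside \<open>X\<close>, the inner operator gives
    zero, which agrees with the other side because \<open>\<phi>\<close> vanishes there.\<close>
  have "suffix 1 (a ## x) = x" by (simp add: fun_eq_iff)
  then show ?thesis
    using sstar one_plus_X_inverse[where ?'r = 'r] fun_space_eq_0[OF assms(2), of "a ## x"]
    by (simp add: alg_act_monomial mult.assoc[symmetric] mult.commute del: One_nat_def)
next
  case (cyl \<alpha> \<beta>)
  then show ?thesis using word_act_cyl[OF assms(2)] by (simp add: alg_act_monomial)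
qed

end

section \<open>The socle of the subshift algebra\<close>

text \<open>The elements acting as zero on \<open>fun_space X\<close> form a two-sided ideal that
  contains all relations, so the action of the free algebra descends to the quotient.\<close>

lemma (in shift_space) subshift_algebra_represented:
  fixes R :: "'r::field itself"
  defines "proj \<equiv> presentation.proj (generators X) (relations X :: (('a generator list \<Rightarrow> 'r) \<times> _) set)"
  shows "\<exists>act. represented_subshift_ring (subshift_algebra R X) X (\<lambda>c. proj (scaled c [])) (p_elem R X)
    (\<lambda>a. proj (monomial [Gen_s a])) (\<lambda>a. proj (monomial [Gen_s_star a])) act"
proof -
  let ?G = "generators X" and ?Rel = "relations X :: (('a generator list \<Rightarrow> 'r) \<times> _) set"
  interpret presentation ?G ?Rel by (rule presentation_relations)
  have B: "subshift_algebra R X = PA" by (simp add: subshift_algebra_def)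
  note proj_def = assms
  have p: "p_elem R X A = proj (monomial [Gen_p A])" for A
    by (simp add: p_elem_def presentation.proj_def[OF presentation_relations] proj_def)
  define Ker where "Ker = {f \<in> carrier FA. \<forall>\<phi>\<in>fun_space X. alg_act X f \<phi> = (\<lambda>x. 0)}"
  have act_diff: "alg_act X (\<lambda>w. f w - g w) \<phi> x = alg_act X f \<phi> x - alg_act X g \<phi> x"
    if "f \<in> carrier FA" "g \<in> carrier FA" for f g \<phi> x
  proof -
    have "(\<lambda>w. f w - g w) \<in> carrier FA"
      using that FA.minus_closed[of f g] by (simp add: free_algebra_minus)
    moreover have "(\<lambda>w. f w - g w) \<oplus>\<^bsub>FA\<^esub> g = f" by (simp add: free_algebra_simps)
    ultimately show ?thesis
      using alg_act_add[of "\<lambda>w. f w - g w" ?G g X \<phi> x] that by simp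
  qed
  have "ideal Ker FA"
  proof (rule idealI)
    show "subgroup Ker (add_monoid FA)"
    proof (rule FA.add.subgroupI)
      show "Ker \<noteq> {}"
        using FA.zero_closed by (auto simp: Ker_def free_algebra_simps intro!: exI[of _ "\<lambda>w. 0"])
    next
      fix f assume f: "f \<in> Ker"
      then have "\<ominus>\<^bsub>FA\<^esub> f = (\<lambda>w. 0 - f w)"
        using free_algebra_minus[of "\<zero>\<^bsub>FA\<^esub>" ?G f] FA.zero_closed
        by (simp add: Ker_def FA.minus_eq) (simp add: free_algebra_simps)
      then show "\<ominus>\<^bsub>FA\<^esub> f \<in> Ker"
        using f act_diff[of "\<lambda>w. 0" f] FA.zero_closed FA.a_inv_closed[of f]
        unfolding Ker_def free_algebra_simps by (simp add: fun_eq_iff[of "alg_act _ _ _"])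
    qed (auto simp: Ker_def alg_act_add[where G = ?G] fun_eq_iff)
  next
    fix f g assume fg: "f \<in> Ker" "g \<in> carrier FA"
    then have f: "f \<in> carrier FA" "\<And>\<phi>. \<phi> \<in> fun_space X \<Longrightarrow> alg_act X f \<phi> = (\<lambda>x. 0)"
      by (auto simp: Ker_def)
    \<comment> \<open>For the second product, \<open>g\<close> keeps \<open>fun_space X\<close>
      invariant; for the first, it sends the zero function to zero.\<close>
    show "g \<otimes>\<^bsub>FA\<^esub> f \<in> Ker" "f \<otimes>\<^bsub>FA\<^esub> g \<in> Ker"
      using f fg(2) alg_act_fun_space[OF _ fg(2)]
      by (simp_all add: Ker_def) (auto intro!: ext simp: alg_act_mult[where G = ?G] alg_act_zero_fun)
  qed (rule ring_free_algebra)
  then have Ker: "relation_ideal ?G ?Rel \<subseteq> Ker"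
  proof (rule relation_ideal_least)
    fix f g assume fg: "(f, g) \<in> ?Rel"
    have "(\<lambda>w. f w - g w) \<in> carrier FA"
      using relations_carrier[OF fg] FA.minus_closed[of f g] by (simp add: free_algebra_minus)
    then show "(\<lambda>w. f w - g w) \<in> Ker"
      using relations_carrier[OF fg] alg_act_relation[OF fg] by (simp add: Ker_def act_diff fun_eq_iff)
  qed
  \<comment> \<open>Any representative serves: two of them differ by an element of the relation
    ideal, hence of \<open>Ker\<close>.\<close>
  define act where "act b \<phi> = alg_act X (SOME f. f \<in> carrier FA \<and> proj f = b) \<phi>" for b \<phi>
  have act: "act (proj f) \<phi> = alg_act X f \<phi>" if "f \<in> carrier FA" "\<phi> \<in> fun_space X" for f \<phi>
  proof -
    define f' where "f' = (SOME f'. f' \<in> carrier FA \<and> proj f' = proj f)"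
    have f': "f' \<in> carrier FA" "proj f' = proj f"
      using someI[of "\<lambda>f'. f' \<in> carrier FA \<and> proj f' = proj f" f] that by (auto simp: f'_def)
    then have "(\<lambda>w. f' w - f w) \<in> Ker"
      using proj_eq_iff[of f' f] that Ker by (auto simp: proj_def)
    then have "alg_act X f' \<phi> = alg_act X f \<phi>"
      using that f' act_diff[of f' f \<phi>] by (auto simp: Ker_def fun_eq_iff)
    then show ?thesis by (simp add: act_def f'_def)
  qed
  note proj = proj_closed[folded proj_def] proj_mult[folded proj_def] proj_add[folded proj_def]
    proj_one[folded proj_def] proj_zero[folded proj_def] carrier_PA[folded proj_def]
    proj_relation[folded proj_def] proj_monomial[folded proj_def] proj_scaled[folded proj_def]
    proj_monomial_Cons[folded proj_def]
  have car: "b \<in> carrier PA \<Longrightarrow> \<exists>f\<in>carrier FA. b = proj f" for b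
    using proj(6) by auto
  have S: "lprod PA (map (\<lambda>a. proj (monomial [Gen_s a])) \<alpha>) = proj (monomial (s_word \<alpha>))" for \<alpha>
    using proj(8)[of "s_word \<alpha>"] word_generators(1)[of \<alpha> X] by (simp add: s_word_def comp_def)
  have T: "lprod PA (map (\<lambda>a. proj (monomial [Gen_s_star a])) (rev \<alpha>)) = proj (monomial (sstar_word \<alpha>))" for \<alpha>
    using proj(8)[of "sstar_word \<alpha>"] word_generators(2)[of \<alpha> X] by (simp add: sstar_word_def comp_def)
  have mon_mult: "proj (monomial u) \<otimes>\<^bsub>PA\<^esub> proj (monomial v) = proj (monomial (u @ v))"
    if "set u \<subseteq> ?G" "set v \<subseteq> ?G" for u v
    using that by (simp add: proj(2)[symmetric] monomial_mult)
  show ?thesis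
    unfolding B p
  proof (intro exI[of _ act], unfold_locales)
    show "proj (scaled r []) \<in> carrier PA" for r by (simp add: proj(1))
    show "proj (scaled (r + r') []) = proj (scaled r []) \<oplus>\<^bsub>PA\<^esub> proj (scaled r' [])" for r r'
      using proj(3)[of "scaled r []" "scaled r' []"]
      by (simp add: free_algebra_simps) (simp add: scaled_def if_distrib cong: if_cong)
    show "proj (scaled (r * r') []) = proj (scaled r []) \<otimes>\<^bsub>PA\<^esub> proj (scaled r' [])" for r r'
      using proj(2)[of "scaled r []" "scaled r' []"] by (simp add: scaled_mult)
    show "proj (scaled 1 []) = \<one>\<^bsub>PA\<^esub>"
      using proj(4) by (simp add: monomial_scaled)
    show "x \<otimes>\<^bsub>PA\<^esub> proj (scaled r []) = proj (scaled r []) \<otimes>\<^bsub>PA\<^esub> x" if "x \<in> carrier PA" for x r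
      using car[OF that] by (auto simp: proj(2)[symmetric] scaled_Nil_comm)
    show "proj (monomial [Gen_p A]) \<in> carrier PA" if "A \<in> \<U> X" for A
      using that by (simp add: proj(1))
    show "proj (monomial [Gen_s a]) \<in> carrier PA" "proj (monomial [Gen_s_star a]) \<in> carrier PA" for a
      by (simp_all add: proj(1))
    show "proj (monomial [Gen_p X]) = \<one>\<^bsub>PA\<^esub>"
      using proj(7)[OF relations.unit] proj(4) by simp
    show "proj (monomial [Gen_p {}]) = \<zero>\<^bsub>PA\<^esub>"
      using proj(7)[OF relations.zero] proj(5) by simp
    show "proj (monomial [Gen_p (A \<inter> D)]) = proj (monomial [Gen_p A]) \<otimes>\<^bsub>PA\<^esub> proj (monomial [Gen_p D])"
      if "A \<in> \<U> X" "D \<in> \<U> X" for A D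
      using proj(7)[OF relations.meet[OF that]] that by (simp add: mon_mult)
    show "proj (monomial [Gen_p (A \<union> D)]) = proj (monomial [Gen_p A]) \<oplus>\<^bsub>PA\<^esub> proj (monomial [Gen_p D])
        \<ominus>\<^bsub>PA\<^esub> proj (monomial [Gen_p (A \<inter> D)])" if AD: "A \<in> \<U> X" "D \<in> \<U> X" for A D
    proof -
      let ?h = "monomial [Gen_p A] \<oplus>\<^bsub>FA\<^esub> monomial [Gen_p D]" and ?m = "monomial [Gen_p (A \<inter> D)]"
      have m: "?h \<in> carrier FA" "?m \<in> carrier FA" "monomial [Gen_p A] \<in> carrier FA" "monomial [Gen_p D] \<in> carrier FA"
        using AD by simp_all
      let ?u = "proj (?h \<ominus>\<^bsub>FA\<^esub> ?m)"
      have u: "?u \<in> carrier PA" "proj ?m \<in> carrier PA"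
        using m by (simp_all add: proj(1))
      have "?u \<oplus>\<^bsub>PA\<^esub> proj ?m = proj ?h"
        using m by (simp add: proj(3)[symmetric] FA.minus_eq FA.a_assoc FA.l_neg)
      then have "proj ?h \<ominus>\<^bsub>PA\<^esub> proj ?m = ?u"
        using u PA.minus_eq PA.a_assoc PA.r_neg by (metis PA.a_inv_closed PA.r_zero)
      moreover have "proj (monomial [Gen_p (A \<union> D)]) = ?u"
        using proj(7)[OF relations.join[OF AD]] unfolding join_conv[OF AD] .
      ultimately show ?thesis
        by (simp only: proj(3)[OF m(3,4)])
    qed
    show "proj (monomial [Gen_s a]) \<otimes>\<^bsub>PA\<^esub> proj (monomial [Gen_s_star a]) \<otimes>\<^bsub>PA\<^esub> proj (monomial [Gen_s a]) =
        proj (monomial [Gen_s a])" for a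
      using proj(7)[OF relations.s] by (simp add: mon_mult)
    show "proj (monomial [Gen_s_star a]) \<otimes>\<^bsub>PA\<^esub> proj (monomial [Gen_s a]) \<otimes>\<^bsub>PA\<^esub> proj (monomial [Gen_s_star a]) =
        proj (monomial [Gen_s_star a])" for a
      using proj(7)[OF relations.sstar] by (simp add: mon_mult)
    show "lprod PA (map (\<lambda>a. proj (monomial [Gen_s a])) \<beta>) \<otimes>\<^bsub>PA\<^esub>
        lprod PA (map (\<lambda>a. proj (monomial [Gen_s_star a])) (rev \<alpha>)) \<otimes>\<^bsub>PA\<^esub>
        lprod PA (map (\<lambda>a. proj (monomial [Gen_s a])) \<alpha>) \<otimes>\<^bsub>PA\<^esub>
        lprod PA (map (\<lambda>a. proj (monomial [Gen_s_star a])) (rev \<beta>)) = proj (monomial [Gen_p (\<C> X \<alpha> \<beta>)])"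
      if "\<alpha> \<in> lang X" "\<beta> \<in> lang X" for \<alpha> \<beta>
      unfolding S T using proj(7)[OF relations.cyl[OF that]] by (simp add: mon_mult)
    show "Z = carrier PA"
      if Z: "Z \<subseteq> carrier PA" "\<one>\<^bsub>PA\<^esub> \<in> Z" "\<And>x y. x \<in> Z \<Longrightarrow> y \<in> Z \<Longrightarrow> x \<oplus>\<^bsub>PA\<^esub> y \<in> Z"
        "\<And>r x. x \<in> Z \<Longrightarrow> proj (scaled r []) \<otimes>\<^bsub>PA\<^esub> x \<in> Z"
        "\<And>A x. A \<in> \<U> X \<Longrightarrow> x \<in> Z \<Longrightarrow> proj (monomial [Gen_p A]) \<otimes>\<^bsub>PA\<^esub> x \<in> Z"
        "\<And>a x. x \<in> Z \<Longrightarrow> proj (monomial [Gen_s a]) \<otimes>\<^bsub>PA\<^esub> x \<in> Z"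
        "\<And>a x. x \<in> Z \<Longrightarrow> proj (monomial [Gen_s_star a]) \<otimes>\<^bsub>PA\<^esub> x \<in> Z" for Z
    proof -
      \<comment> \<open>Words enter \<open>Z\<close> by prepending generators to 1; linear
        combinations follow.\<close>
      have mon: "proj (monomial w) \<in> Z" if "set w \<subseteq> ?G" for w
        using that
      proof (induction w)
        case (Cons g w)
        then show ?case using proj(10)[of g w] Z(5-7) by (cases g) simp_all
      qed (use Z(2) proj(4) in simp)
      have "proj f \<in> Z" if "f \<in> carrier FA" for f
        using that
      proof (induction rule: free_algebra_induct)
        case zero
        have "scaled 0 [] = (\<lambda>w :: 'a generator list. 0 :: 'r)" by (simp add: scaled_def fun_eq_iff)
        then have "proj (\<lambda>w. 0) = proj (scaled 0 []) \<otimes>\<^bsub>PA\<^esub> \<one>\<^bsub>PA\<^esub>"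
          using proj(5) by simp
        then show ?case using Z(2,4) by simp
      next
        case (add c w f)
        then show ?case using Z(3,4) mon[of w] by (simp add: proj(3) proj(9)[of w])
      qed
      then show ?thesis using Z(1) proj(6) by auto
    qed
    show "act b \<phi> \<in> fun_space X" if "b \<in> carrier PA" "\<phi> \<in> fun_space X" for b \<phi>
      using car[OF that(1)] that(2) by (auto simp: act alg_act_fun_space)
    show "act (b \<otimes>\<^bsub>PA\<^esub> c) \<phi> = act b (act c \<phi>)"
      if "b \<in> carrier PA" "c \<in> carrier PA" "\<phi> \<in> fun_space X" for b c \<phi>
      using car[OF that(1)] car[OF that(2)] that(3)
      by (auto simp: act alg_act_fun_space proj(2)[symmetric] alg_act_mult[where G = ?G] fun_eq_iff)
    show "act (b \<oplus>\<^bsub>PA\<^esub> c) \<phi> x = act b \<phi> x + act c \<phi> x"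
      if "b \<in> carrier PA" "c \<in> carrier PA" "\<phi> \<in> fun_space X" for b c \<phi> x
      using car[OF that(1)] car[OF that(2)] that(3)
      by (auto simp: act proj(3)[symmetric] alg_act_add[where G = ?G])
    show "act b (\<lambda>x. f * \<phi> x) x = f * act b \<phi> x"
      if b: "b \<in> carrier PA" and \<phi>: "\<phi> \<in> fun_space X" for b \<phi> f x
    proof -
      obtain g where g: "g \<in> carrier FA" "b = proj g" using car[OF b] by blast
      have "(\<lambda>x. f * \<phi> x) \<in> fun_space X" using \<phi> by (simp add: fun_space_def)
      then show ?thesis
        using alg_act_linear[of X g f \<phi> "\<lambda>x. 0" x] g \<phi> by (simp add: act alg_act_zero_fun)
    qed
    show "act (proj (scaled r [])) \<phi> x = fps_const r * \<phi> x" if "\<phi> \<in> fun_space X" for r \<phi> x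
      using that by (simp add: act alg_act_scaled)
    show "act (proj (monomial [Gen_p A])) \<phi> x = (if x \<in> A then \<phi> x else 0)"
      if "A \<in> \<U> X" "\<phi> \<in> fun_space X" for A \<phi> x
      using that by (simp add: act alg_act_monomial)
    show "act (proj (monomial [Gen_s_star a])) \<phi> x = (1 + fps_X) * \<phi> (a ## x)"
      if "\<phi> \<in> fun_space X" for a \<phi> x
      using that by (simp add: act alg_act_monomial)
  qed
qed

section \<open>The case of the empty subshift\<close>

lemma sum_left_ideals_empty: "sum_left_ideals B {} I = {\<zero>\<^bsub>B\<^esub>}" if "ring B"
proof -
  interpret ring B by fact
  show ?thesis by (auto simp: sum_left_ideals_def)
qed

lemma left_socle_trivial:
  assumes "ring B" "\<one>\<^bsub>B\<^esub> = \<zero>\<^bsub>B\<^esub>"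
  shows "left_socle B = {\<zero>\<^bsub>B\<^esub>}"
proof -
  interpret ring B by fact
  have "I = {\<zero>\<^bsub>B\<^esub>}" if "left_ideal I B" for I
    using left_ideal_subset[OF that] one_zeroD[OF assms(2)] that
    by (auto simp: left_ideal_def additive_subgroup.zero_closed)
  then have "{I. minimal_left_ideal I B} = {}"
    by (auto simp: minimal_left_ideal_def)
  then show ?thesis
    unfolding left_socle_def by (simp add: sum_left_ideals_empty[OF assms(1)])
qed

theorem theorem4p2:
  fixes X :: "'a word set" and R :: "'r::field itself"
  assumes "subshift X"
    and "\<And>a. X \<noteq> {} \<Longrightarrow> [a] \<in> lang X"
  shows "left_socle (subshift_algebra R X) =
    sum_left_ideals (subshift_algebra R X) (\<Q> X)
      (\<lambda>A. {b \<otimes>\<^bsub>subshift_algebra R X\<^esub> p_elem R X A | b. b \<in> carrier (subshift_algebra R X)})"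
proof (cases "X = {}")
  case True
  \<comment> \<open>Without points no letter is in the language, so \<open>shift_space\<close> does
    not apply. But the projections of \<open>X\<close> and of the empty set coincide, hence 1 equals
    0 and both sides are zero.\<close>
  interpret presentation "generators X" "relations X :: (('a generator list \<Rightarrow> 'r) \<times> _) set"
    by (rule presentation_relations)
  have B: "subshift_algebra R X = PA" by (simp add: subshift_algebra_def)
  have "\<one>\<^bsub>PA\<^esub> = \<zero>\<^bsub>PA\<^esub>"
    using proj_relation[OF relations.unit] proj_relation[OF relations.zero] proj_one proj_zero True by simp
  then have "left_socle PA = {\<zero>\<^bsub>PA\<^esub>}"
    by (rule left_socle_trivial[OF PA.ring_axioms])
  moreover have "\<Q> X = {}"
    using True U_subset[of _ X] by (fastforce simp: \<Q>_def)
  ultimately show ?thesis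
    unfolding B by (simp add: sum_left_ideals_empty[OF PA.ring_axioms])
next
  case False
  interpret shift_space X
    using subshift_suffix_closed[OF assms(1)] assms(2)[OF False] by unfold_locales
  show ?thesis
    using subshift_algebra_represented[of R] by (elim exE) (rule represented_subshift_ring.left_socle_eq)
qed

end
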